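(* Let $N\ge1$, $s\in(0,1)$, let $u_0\in C_0^\infty(\mathbb{R}^N)$ with $\operatorname{supp}(u_0)\subset B_L(0)$ for some $L>0$, and let $w=w(x,t)$ be the solution of the Cauchy problem for the fractional wave equation $$\partial_t^2w+(-\Delta)^sw=0\ \text{ in }\mathbb{R}^N\times(0,\infty),\qquad w(x,0)=0,\quad \partial_tw(x,0)=u_0(x)\ \text{ for }x\in\mathbb{R}^N.$$ Then the following conditions are equivalent: (1) $\nabla_xw(0,t)=0$ for any $t>0$; (2) $\displaystyle\int_{\mathbb{S}^{N-1}}\omega\,u_0(r\omega)\,d\omega=0$ for any $r\ge0$.
   Context: $B_L(0)$ is the open ball of radius $L$ centered at the origin of $\mathbb{R}^N$; $\mathbb{S}^{N-1}$ is the unit sphere centered at the origin with surface measure $d\omega$ (counting measure on $\{\pm1\}$ if $N=1$); the integral in (2) is $\mathbb{R}^N$-valued. The fractional Laplacian is $(-\Delta)^s u(x)=c_{N,s}\lim_{\varepsilon\to0^+}\int_{|y-x|>\varepsilon}\frac{u(x)-u(y)}{|x-y|^{N+2s}}\,dy$ with $c_{N,s}=\frac{2^{2s}s\,\Gamma((N+2s)/2)}{\pi^{N/2}\Gamma(1-s)}$; equivalently, with the Fourier transform $\mathcal{F}f(\xi)=\int_{\mathbb{R}^N}f(x)e^{-2\pi i x\cdot\xi}dx$, it is the Fourier multiplier with symbol $(2\pi|\xi|)^{2s}$. The solution of the Cauchy problem is the smooth one obtained by Fourier transform in $x$: $w(\cdot,t)=\mathcal{F}^{-1}\Big(\frac{\sin(t(2\pi|\xi|)^s)}{(2\pi|\xi|)^s}\,\mathcal{F}u_0(\xi)\Big)$.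 *)

theory Defs
  imports "HOL-Analysis.Analysis"
begin

text \<open>
  \<open>Ck_on k S f\<close>: \<open>f\<close> is \<open>k\<close> times continuously differentiable on the open set \<open>S\<close>.
  On a Euclidean space, requiring the directional derivatives \<open>\<lambda>x. f' x h\<close> to be \<open>C\<^sup>k\<close> for every
  fixed direction \<open>h\<close> is the same as requiring it of the partial derivatives.
\<close>

primrec Ck_on ::
  "nat \<Rightarrow> 'a::real_normed_vector set \<Rightarrow> ('a \<Rightarrow> 'b::real_normed_vector) \<Rightarrow> bool" where
  "Ck_on 0 S f \<longleftrightarrow> continuous_on S f"
| "Ck_on (Suc k) S f \<longleftrightarrow>
     (\<exists>f'. (\<forall>x\<in>S. (f has_derivative f' x) (at x)) \<and> (\<forall>h. Ck_on k S (\<lambda>x. f' x h)))"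

definition smooth_on :: "'a::real_normed_vector set \<Rightarrow> ('a \<Rightarrow> 'b::real_normed_vector) \<Rightarrow> bool" where
  "smooth_on S f \<longleftrightarrow> (\<forall>k. Ck_on k S f)"

definition supp :: "('a::topological_space \<Rightarrow> 'b::zero) \<Rightarrow> 'a set" where
  "supp f = closure {x. f x \<noteq> 0}"

definition test_function :: "('a::euclidean_space \<Rightarrow> real) \<Rightarrow> bool" where
  "test_function u \<longleftrightarrow> smooth_on UNIV u \<and> compact (supp u)"

text \<open>
  Surface measure on the unit sphere: \<open>\<sigma>(A) = N \<cdot> |{r\<omega>. 0 < r < 1, \<omega> \<in> A}|\<close>,
  which is the measure for which integration in polar coordinates reads
  \<open>\<integral> f(x) dx = \<integral>\<^sub>0\<^sup>\<infinity> r\<^sup>N\<^sup>-\<^sup>1 \<integral> f(r\<omega>) d\<omega> dr\<close>.  Here \<open>sgn x\<close> is the radial projection \<open>x / |x|\<close>.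
  For \<open>N = 1\<close> this gives each of \<open>1\<close> and \<open>-1\<close> mass \<open>1\<close>.
\<close>

definition sphere_measure :: "'a::euclidean_space measure" where
  "sphere_measure =
     scale_measure (of_nat DIM('a))
       (distr (restrict_space lborel (ball 0 1 - {0})) (restrict_space borel (sphere 0 1)) sgn)"

definition fourier :: "('a::euclidean_space \<Rightarrow> complex) \<Rightarrow> 'a \<Rightarrow> complex" where
  "fourier f \<xi> = (\<integral>x. f x * exp (- 2 * pi * \<i> * of_real (x \<bullet> \<xi>)) \<partial>lborel)"

definition inverse_fourier :: "('a::euclidean_space \<Rightarrow> complex) \<Rightarrow> 'a \<Rightarrow> complex" where
  "inverse_fourier g x = (\<integral>\<xi>. g \<xi> * exp (2 * pi * \<i> * of_real (x \<bullet> \<xi>)) \<partial>lborel)"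

definition frac_laplacian_const :: "nat \<Rightarrow> real \<Rightarrow> real" where
  "frac_laplacian_const N s =
     2 powr (2 * s) * s * Gamma ((real N + 2 * s) / 2) / (pi powr (real N / 2) * Gamma (1 - s))"

text \<open>
  \<open>has_frac_laplacian s u x l\<close>: the principal value defining \<open>(-\<Delta>)\<^sup>s u(x)\<close> exists and equals \<open>l\<close>.
  Integrability is demanded explicitly because the Bochner integral of a non-integrable
  function is \<open>0\<close>.
\<close>

definition has_frac_laplacian ::
  "real \<Rightarrow> ('a::euclidean_space \<Rightarrow> real) \<Rightarrow> 'a \<Rightarrow> real \<Rightarrow> bool" where
  "has_frac_laplacian s u x l \<longleftrightarrow>
     (let k = (\<lambda>y. (u x - u y) / norm (x - y) powr (real DIM('a) + 2 * s));
          A = (\<lambda>\<epsilon>. {y. norm (y - x) > \<epsilon>})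
      in (\<forall>\<epsilon>>0. set_integrable lborel (A \<epsilon>) k) \<and>
         ((\<lambda>\<epsilon>. frac_laplacian_const DIM('a) s * (LINT y:A \<epsilon>|lborel. k y)) \<longlongrightarrow> l) (at_right 0))"

text \<open>
  Classical solutions of \<open>\<partial>\<^sub>t\<^sup>2 w + (-\<Delta>)\<^sup>s w = 0\<close>, \<open>w(\<cdot>,0) = 0\<close>, \<open>\<partial>\<^sub>t w(\<cdot>,0) = u\<^sub>0\<close>; only the values
  \<open>w x t\<close> with \<open>t \<ge> 0\<close> matter, so the time derivative at \<open>0\<close> is one-sided.
\<close>

definition solves_frac_wave ::
  "real \<Rightarrow> ('a::euclidean_space \<Rightarrow> real) \<Rightarrow> ('a \<Rightarrow> real \<Rightarrow> real) \<Rightarrow> bool" where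
  "solves_frac_wave s u\<^sub>0 w \<longleftrightarrow>
     smooth_on (UNIV \<times> {0<..}) (\<lambda>(x, t). w x t) \<and>
     (\<forall>x. \<forall>t>0. \<exists>w\<^sub>t\<^sub>t l. (deriv (w x) has_real_derivative w\<^sub>t\<^sub>t) (at t) \<and>
                      has_frac_laplacian s (\<lambda>y. w y t) x l \<and> w\<^sub>t\<^sub>t + l = 0) \<and>
     (\<forall>x. w x 0 = 0) \<and>
     (\<forall>x. (w x has_real_derivative u\<^sub>0 x) (at 0 within {0..}))"

text \<open>
  Instead of imposing a growth condition for uniqueness, we single out the solution that is
  obtained by Fourier transform in \<open>x\<close>.  At \<open>\<xi> = 0\<close> the quotient below is
  \<open>0 / 0 = 0\<close> instead of its limit \<open>t\<close>, which does not affect the integral.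
\<close>

definition frac_wave_solution ::
  "real \<Rightarrow> ('a::euclidean_space \<Rightarrow> real) \<Rightarrow> ('a \<Rightarrow> real \<Rightarrow> real) \<Rightarrow> bool" where
  "frac_wave_solution s u\<^sub>0 w \<longleftrightarrow>
     solves_frac_wave s u\<^sub>0 w \<and>
     (\<forall>t\<ge>0. \<forall>x. complex_of_real (w x t) =
        inverse_fourier (\<lambda>\<xi>. of_real (sin (t * (2 * pi * norm \<xi>) powr s) / (2 * pi * norm \<xi>) powr s) *
                             fourier (\<lambda>y. of_real (u\<^sub>0 y)) \<xi>) x)"

end

theory Submission
  imports Defs "HOL-Probability.Probability"
begin

text \<open>
  Every step tests against radial functions. Write \<open>\<F>u\<close> for the Fourier transform of \<open>u\<^sub>0\<close>. The component
  of \<open>\<nabla>w(0,t)\<close> along \<open>h\<close> is \<open>-2\<pi> \<integral> sin(t|2\<pi>\<xi>|\<^sup>s) / |2\<pi>\<xi>|\<^sup>s (h \<bullet> \<xi>) Im \<F>u(\<xi>) d\<xi>\<close>. By uniqueness of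
  characteristic functions (of the push-forward under \<open>|2\<pi>\<xi>|\<^sup>s\<close>) its vanishing for all \<open>t\<close> means that
  \<open>(h \<bullet> \<xi>) Im \<F>u(\<xi>)\<close> annihilates all Gaussians \<open>exp(-c|\<xi>|\<^sup>2)\<close>; the converse is uniqueness of Laplace
  transforms. Since the Fourier transform of a Gaussian is a Gaussian, this is the same as \<open>(h \<bullet> x) u\<^sub>0(x)\<close>
  annihilating all Gaussians, which by Laplace uniqueness again and polar coordinates is condition (2).
\<close>

text \<open>Gaussians serve as the link because they are radial on both sides of the Fourier
  transform, so no Bessel kernel or Hankel transform enters. The parameter \<open>c\<close> goes to
  \<open>pi\<^sup>2 / c\<close>, hence a statement for all \<open>c > 0\<close> carries over
  unchanged. Every test is a function of the norm and so, for a fixed direction \<open>h\<close>,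
  sees only spherical averages. Two obstacles shape the argument. In \<open>t\<close> only sines
  occur, whereas uniqueness of characteristic functions asks for sines and cosines; the sign of
  \<open>h \<bullet> \<xi>\<close> and the oddness of the imaginary part of the transform supply the
  cosines. The division by the power \<open>s\<close> of the frequency is singular at the origin;
  the factor \<open>h \<bullet> \<xi>\<close> compensates it, \<open>s < 1\<close> making the ratio
  bounded there.\<close>

section \<open>Uniqueness of Fourier and Laplace transforms\<close>

text \<open>The positive and negative parts of \<open>g\<close> have equal mass, by the cosine
  hypothesis at \<open>t = 0\<close>. Normalized and pushed forward under \<open>\<phi>\<close>,
  they become probability distributions on the line with the same characteristic function, hence
  equal. So both parts give the same integral of \<open>f\<close>.\<close>

lemma integral_eq_0_of_char_eq_0:
  fixes \<phi> g :: "'a \<Rightarrow> real" and f :: "real \<Rightarrow> real"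
  assumes g: "integrable M g" and [measurable]: "\<phi> \<in> borel_measurable M" "f \<in> borel_measurable borel"
    and cos0: "\<And>t. (\<integral>x. cos (t * \<phi> x) * g x \<partial>M) = 0"
    and sin0: "\<And>t. (\<integral>x. sin (t * \<phi> x) * g x \<partial>M) = 0"
    and fg: "integrable M (\<lambda>x. f (\<phi> x) * g x)"
  shows "(\<integral>x. f (\<phi> x) * g x \<partial>M) = 0"
proof -
  have [measurable]: "g \<in> borel_measurable M" using g by simp
  define p where "p x = max 0 (g x)" for x
  define q where "q x = max 0 (- g x)" for x
  have [measurable]: "p \<in> borel_measurable M" "q \<in> borel_measurable M"
    unfolding p_def q_def by measurable
  have p: "integrable M p" "\<And>x. 0 \<le> p x" and q: "integrable M q" "\<And>x. 0 \<le> q x"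
    unfolding p_def q_def using g by (auto intro!: integrable_max)
  have gpq: "g x = p x - q x" for x unfolding p_def q_def by auto
  have pg: "\<bar>p x\<bar> \<le> \<bar>g x\<bar>" "\<bar>q x\<bar> \<le> \<bar>g x\<bar>" for x unfolding p_def q_def by auto
  have eq: "(\<integral>x. k x * p x \<partial>M) = (\<integral>x. k x * q x \<partial>M)"
    if k: "(\<integral>x. k x * g x \<partial>M) = 0" "integrable M (\<lambda>x. k x * g x)" "k \<in> borel_measurable M" for k :: "'a \<Rightarrow> real"
  proof -
    note k(3)[measurable]
    have "integrable M (\<lambda>x. k x * p x)" "integrable M (\<lambda>x. k x * q x)"
      by (auto intro!: Bochner_Integration.integrable_bound[OF k(2)] AE_I2 mult_left_mono pg simp: abs_mult)
    then have "(\<integral>x. k x * p x \<partial>M) - (\<integral>x. k x * q x \<partial>M) = (\<integral>x. k x * g x \<partial>M)"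
      by (subst Bochner_Integration.integral_diff[symmetric]) (auto simp: gpq algebra_simps)
    then show ?thesis using k by simp
  qed
  have bdd: "integrable M (\<lambda>x. k x * g x)"
    if "k \<in> borel_measurable M" "\<And>x. \<bar>k x\<bar> \<le> 1" for k :: "'a \<Rightarrow> real"
  proof -
    note that(1)[measurable]
    show ?thesis
      by (rule Bochner_Integration.integrable_bound[OF g]) 
         (auto intro!: AE_I2 mult_left_le_one_le that simp: abs_mult)
  qed
  define m where "m = (\<integral>x. p x \<partial>M)"
  have mq: "(\<integral>x. q x \<partial>M) = m"
    using eq[of "\<lambda>_. 1"] cos0[of 0] g by (simp add: m_def)
  show ?thesis
  \<comment> \<open>For mass zero no normalization is possible, but then both parts vanish almost
    everywhere.\<close>
  proof (cases "m = 0")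
    case True
    have "AE x in M. p x = 0" "AE x in M. q x = 0"
      using True mq integral_nonneg_eq_0_iff_AE[OF p(1)] integral_nonneg_eq_0_iff_AE[OF q(1)] p(2) q(2)
      by (auto simp: m_def)
    then have "AE x in M. f (\<phi> x) * g x = 0" by eventually_elim (simp add: gpq)
    then show ?thesis by (rule integral_eq_zero_AE)
  next
    case False
    then have m: "m > 0" using p(2) unfolding m_def
      by (simp add: order_less_le)
    define N where "N r = distr (density M (\<lambda>x. ennreal (r x / m))) borel \<phi>" for r :: "'a \<Rightarrow> real"
    have N: "real_distribution (N r)"
      and int: "k \<in> borel_measurable borel \<Longrightarrow> (\<integral>y. k y \<partial>N r) = (\<integral>x. k (\<phi> x) * r x \<partial>M) / m"
      if [measurable]: "r \<in> borel_measurable M" and r: "integrable M r" "\<And>x. 0 \<le> r x" "(\<integral>x. r x \<partial>M) = m"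
      for r :: "'a \<Rightarrow> real" and k :: "real \<Rightarrow> real"
    proof -
      have "(\<integral>\<^sup>+x. ennreal (r x / m) \<partial>M) = ennreal (\<integral>x. r x / m \<partial>M)"
        using r m by (intro nn_integral_eq_integral) auto
      also have "\<dots> = 1" using m r by simp
      finally have "prob_space (density M (\<lambda>x. ennreal (r x / m)))"
        by (intro prob_spaceI) (simp add: emeasure_density cong: nn_integral_cong)
      then show "real_distribution (N r)" unfolding N_def
        by (intro prob_space.real_distribution_distr) auto
      show "(\<integral>y. k y \<partial>N r) = (\<integral>x. k (\<phi> x) * r x \<partial>M) / m" if [measurable]: "k \<in> borel_measurable borel"
        unfolding N_def using m r by (simp add: integral_distr integral_density mult.commute)
    qed
    have pN: "real_distribution (N p)" and qN: "real_distribution (N q)"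
      using N[of p] N[of q] p q mq by (auto simp: m_def)
    have ch: "char (N r) t = of_real (\<integral>x. cos (t * \<phi> x) * r x \<partial>M) / m + \<i> * of_real (\<integral>x. sin (t * \<phi> x) * r x \<partial>M) / m"
      if "r = p \<or> r = q" for r t
    proof -
      interpret real_distribution "N r" using that pN qN by auto
      have "char (N r) t = (\<integral>y. of_real (cos (t * y)) + \<i> * of_real (sin (t * y)) \<partial>N r)"
        unfolding char_def by (intro Bochner_Integration.integral_cong) (auto simp: complex_eq_iff Re_exp Im_exp)
      also have "\<dots> = of_real (\<integral>y. cos (t * y) \<partial>N r) + \<i> * of_real (\<integral>y. sin (t * y) \<partial>N r)"
        by (subst Bochner_Integration.integral_add)
           (auto intro!: integrable_const_bound[where B=1] AE_I2 simp: norm_mult)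
      finally show ?thesis
        using that p q mq by (auto simp: int m_def)
    qed
    have "char (N p) = char (N q)"
    proof
      fix t
      show "char (N p) t = char (N q) t"
        using eq[of "\<lambda>x. cos (t * \<phi> x)"] eq[of "\<lambda>x. sin (t * \<phi> x)"] cos0[of t] sin0[of t] 
        by (simp add: ch bdd)
    qed
    then have "N p = N q" using Levy_uniqueness pN qN by blast
    then have "(\<integral>x. f (\<phi> x) * p x \<partial>M) = (\<integral>x. f (\<phi> x) * q x \<partial>M)"
      using int[of p f] int[of q f] p q mq m by (simp add: m_def)
    moreover have "integrable M (\<lambda>x. f (\<phi> x) * p x)" "integrable M (\<lambda>x. f (\<phi> x) * q x)"
      by (auto intro!: Bochner_Integration.integrable_bound[OF fg] AE_I2 mult_left_mono pg simp: abs_mult)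
    ultimately show ?thesis
      by (simp add: gpq right_diff_distrib)
  qed
qed

text \<open>With \<open>y = exp (- \<phi>)\<close>, the transform at \<open>c = n + 1\<close> is the
  \<open>n\<close>-th moment of \<open>y\<close> against the weight \<open>y g\<close>. Since
  \<open>y\<close> is bounded, the power series of cosine and sine can be integrated termwise, and
  vanishing moments give a vanishing Fourier transform of \<open>y\<close>. The extra factor
  \<open>y\<close> in the weight shifts the exponents away from \<open>c = 0\<close>, where nothing
  is assumed.\<close>

lemma integral_eq_0_of_laplace_eq_0:
  fixes \<phi> g :: "'a \<Rightarrow> real" and f :: "real \<Rightarrow> real"
  assumes g: "integrable M g" and [measurable]: "\<phi> \<in> borel_measurable M" "f \<in> borel_measurable borel"
    and pos: "\<And>x. 0 \<le> \<phi> x"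
    and lap: "\<And>c. c > 0 \<Longrightarrow> (\<integral>x. exp (- (c * \<phi> x)) * g x \<partial>M) = 0"
    and fg: "integrable M (\<lambda>x. f (\<phi> x) * g x)"
  shows "(\<integral>x. f (\<phi> x) * g x \<partial>M) = 0"
proof -
  have [measurable]: "g \<in> borel_measurable M" using g by simp
  define y where "y x = exp (- \<phi> x)" for x
  have y: "0 < y x" "y x \<le> 1" for x using pos by (auto simp: y_def)
  have [measurable]: "y \<in> borel_measurable M" unfolding y_def by measurable
  have yn: "(\<integral>x. y x ^ n * (y x * g x) \<partial>M) = 0" for n
  proof -
    have "y x ^ n * y x = exp (- (real (Suc n) * \<phi> x))" for x
      unfolding y_def by (simp add: exp_of_nat_mult[symmetric] exp_add[symmetric] algebra_simps)
    then show ?thesis using lap[of "Suc n"] by (simp add: mult.assoc[symmetric])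
  qed
  have yg: "integrable M (\<lambda>x. y x * g x)"
    by (rule Bochner_Integration.integrable_bound[OF g])
       (use y in \<open>auto intro!: AE_I2 mult_left_le_one_le simp: abs_mult less_imp_le\<close>)
  \<comment> \<open>The coefficient bound covers cosine and sine at once; with
    \<open>y \<le> 1\<close> the terms are dominated by the exponential series at
    \<open>\<bar>t\<bar>\<close>.\<close>
  have ser: "(\<integral>x. F (t * y x) * (y x * g x) \<partial>M) = 0"
    if F: "\<And>z. (\<lambda>n. a n * z ^ n) sums F z" and a: "\<And>n. \<bar>a n\<bar> \<le> 1 / fact n"
    for F :: "real \<Rightarrow> real" and a t
  proof -
    have bound: "\<bar>a n * (t * y x) ^ n * (y x * g x)\<bar> \<le> (\<bar>t\<bar> ^ n / fact n) * \<bar>y x * g x\<bar>" for n x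
    proof -
      have "\<bar>a n * (t * y x) ^ n\<bar> \<le> (1 / fact n) * \<bar>t\<bar> ^ n"
        unfolding abs_mult power_abs using y[of x] 
        by (intro mult_mono a power_mono) (auto simp: mult_left_le abs_mult)
      then show ?thesis unfolding abs_mult[of "a n * (t * y x) ^ n"] by (intro mult_right_mono) auto
    qed
    have sf: "summable (\<lambda>n. \<bar>t\<bar> ^ n / fact n)"
      using summable_exp[of "\<bar>t\<bar>"] by (simp add: field_simps)
    have int: "integrable M (\<lambda>x. a n * (t * y x) ^ n * (y x * g x))" for n
      by (rule Bochner_Integration.integrable_bound[where f = "\<lambda>x. (\<bar>t\<bar> ^ n / fact n) * \<bar>y x * g x\<bar>"])
         (use bound yg in \<open>auto intro!: AE_I2 simp del: abs_mult\<close>)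
    have "(\<lambda>n. \<integral>x. a n * (t * y x) ^ n * (y x * g x) \<partial>M) sums (\<integral>x. (\<Sum>n. a n * (t * y x) ^ n * (y x * g x)) \<partial>M)"
    proof (rule sums_integral[OF int])
      show "AE x in M. summable (\<lambda>n. norm (a n * (t * y x) ^ n * (y x * g x)))"
        by (intro AE_I2 summable_comparison_test'[OF summable_mult2[OF sf]]) (use bound in auto)
      show "summable (\<lambda>n. \<integral>x. norm (a n * (t * y x) ^ n * (y x * g x)) \<partial>M)"
      proof (rule summable_comparison_test'[OF summable_mult2[OF sf]])
        fix n
        have "(\<integral>x. norm (a n * (t * y x) ^ n * (y x * g x)) \<partial>M) \<le> (\<integral>x. (\<bar>t\<bar> ^ n / fact n) * \<bar>y x * g x\<bar> \<partial>M)"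
          by (intro integral_mono) (use bound int yg in auto)
        then show "norm (\<integral>x. norm (a n * (t * y x) ^ n * (y x * g x)) \<partial>M) \<le> (\<bar>t\<bar> ^ n / fact n) * (\<integral>x. \<bar>y x * g x\<bar> \<partial>M)"
          by simp
      qed
    qed
    moreover have "(\<integral>x. a n * (t * y x) ^ n * (y x * g x) \<partial>M) = 0" for n
    proof -
      have "(\<integral>x. a n * (t * y x) ^ n * (y x * g x) \<partial>M) = (\<integral>x. (a n * t ^ n) * (y x ^ n * (y x * g x)) \<partial>M)"
        by (simp add: power_mult_distrib algebra_simps)
      also have "\<dots> = 0" using yn[of n] by simp
      finally show ?thesis .
    qed
    moreover have "(\<Sum>n. a n * (t * y x) ^ n * (y x * g x)) = F (t * y x) * (y x * g x)" for x
      using sums_mult2[OF F, of "t * y x" "y x * g x"] by (rule sums_unique[symmetric])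
    ultimately show ?thesis using sums_unique by fastforce
  qed
  \<comment> \<open>\<open>- ln\<close> recovers \<open>\<phi>\<close> from \<open>y\<close>, and
    the division by \<open>z\<close> removes the extra weight.\<close>
  have "(\<integral>x. (\<lambda>z. f (- ln z) / z) (y x) * (y x * g x) \<partial>M) = 0"
  proof (rule integral_eq_0_of_char_eq_0[OF yg, where \<phi> = y and f = "\<lambda>z. f (- ln z) / z"])
    show "(\<integral>x. cos (t * y x) * (y x * g x) \<partial>M) = 0" for t
      by (rule ser[of cos_coeff]) (use cos_converges in \<open>simp_all add: cos_coeff_def flip: real_scaleR_def\<close>)
    show "(\<integral>x. sin (t * y x) * (y x * g x) \<partial>M) = 0" for t
      by (rule ser[of sin_coeff]) (use sin_converges in \<open>simp_all add: sin_coeff_def flip: real_scaleR_def\<close>)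
    show "integrable M (\<lambda>x. (\<lambda>z. f (- ln z) / z) (y x) * (y x * g x))"
      using fg y by (simp add: y_def)
  qed auto
  then show ?thesis by (simp add: y_def)
qed

section \<open>Test functions\<close>

lemma lborel_integral_translate:
  fixes f :: "'a::euclidean_space \<Rightarrow> 'b::{banach, second_countable_topology}"
  assumes [measurable]: "f \<in> borel_measurable borel"
  shows "(\<integral>x. f (x + a) \<partial>lborel) = (\<integral>x. f x \<partial>lborel)"
proof -
  have "(\<integral>x. f x \<partial>lborel) = (\<integral>x. f x \<partial>distr lborel borel ((+) a))"
    by (simp add: lborel_distr_plus)
  also have "\<dots> = (\<integral>x. f (x + a) \<partial>lborel)"
    by (simp add: integral_distr add.commute)
  finally show ?thesis by simp
qed

lemma integrable_continuous_bounded_support: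
  fixes f :: "'a::euclidean_space \<Rightarrow> 'b::{banach, second_countable_topology}"
  assumes "continuous_on UNIV f" "\<And>x. R < norm x \<Longrightarrow> f x = 0"
  shows "integrable lborel f"
proof -
  have "set_integrable lborel (cball 0 R) f"
    unfolding set_integrable_def
    by (rule borel_integrable_compact) (auto intro: continuous_on_subset[OF assms(1)])
  moreover have "(\<lambda>x. indicator (cball 0 R) x *\<^sub>R f x) = f"
    using assms(2) by (auto simp: fun_eq_iff indicator_def not_le)
  ultimately show ?thesis by (simp add: set_integrable_def)
qed

lemma bounded_continuous_bounded_support:
  fixes f :: "'a::euclidean_space \<Rightarrow> 'b::real_normed_vector"
  assumes "continuous_on UNIV f" "\<And>x. R < norm x \<Longrightarrow> f x = 0"
  obtains B where "B > 0" "\<And>x. norm (f x) \<le> B"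
proof -
  have "bounded (f ` cball 0 R)"
    by (intro compact_imp_bounded compact_continuous_image continuous_on_subset[OF assms(1)]) auto
  then obtain B where B: "B > 0" "\<And>x. x \<in> cball 0 R \<Longrightarrow> norm (f x) \<le> B"
    unfolding bounded_pos by auto
  show thesis
    by (rule that[of B]) (use B assms(2) in \<open>force simp: not_le\<close>)+
qed

text \<open>The mean value inequality on the line through \<open>x\<close> in direction
  \<open>h\<close>, using a bound on the derivative in that one direction. It provides the uniform
  domination of difference quotients under an integral.\<close>

lemma norm_directional_increment_le:
  fixes f :: "'a::real_normed_vector \<Rightarrow> 'b::real_normed_vector"
  assumes "\<And>x. (f has_derivative f' x) (at x)" "\<And>x. norm (f' x h) \<le> B"
  shows "norm (f (x + t *\<^sub>R h) - f x) \<le> B * \<bar>t\<bar>"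
proof -
  have "norm ((\<lambda>t. f (x + t *\<^sub>R h)) t - (\<lambda>t. f (x + t *\<^sub>R h)) 0) \<le> B * norm (t - 0)"
  proof (rule differentiable_bound[where S = UNIV and f' = "\<lambda>t s. s *\<^sub>R f' (x + t *\<^sub>R h) h"])
    fix t :: real
    have "((\<lambda>t. f (x + t *\<^sub>R h)) has_derivative (\<lambda>s. f' (x + t *\<^sub>R h) (s *\<^sub>R h))) (at t)"
      by (rule has_derivative_compose[OF _ assms(1)]) (auto intro!: derivative_eq_intros)
    moreover have "f' (x + t *\<^sub>R h) (s *\<^sub>R h) = s *\<^sub>R f' (x + t *\<^sub>R h) h" for s
      by (rule linear_scale[OF has_derivative_linear, OF assms(1)])
    ultimately show "((\<lambda>t. f (x + t *\<^sub>R h)) has_derivative (\<lambda>s. s *\<^sub>R f' (x + t *\<^sub>R h) h)) (at t within UNIV)"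
      by simp
    show "onorm (\<lambda>s. s *\<^sub>R f' (x + t *\<^sub>R h) h) \<le> B"
      by (rule onorm_le) (use mult_left_mono[OF assms(2) abs_ge_zero] in \<open>simp add: mult.commute\<close>)
  qed auto
  then show ?thesis by simp
qed

text \<open>Increments \<open>1 / (n + 1)\<close> make the limit sequential, so that it combines
  with dominated convergence.\<close>

lemma directional_difference_quotient:
  fixes f :: "'a::real_normed_vector \<Rightarrow> 'b::real_normed_vector"
  assumes "(f has_derivative f') (at x)"
  shows "(\<lambda>n. real (Suc n) *\<^sub>R (f (x + inverse (real (Suc n)) *\<^sub>R h) - f x)) \<longlonglongrightarrow> f' h"
proof -
  have "((\<lambda>t. f (x + t *\<^sub>R h)) has_derivative (\<lambda>s. f' (s *\<^sub>R h))) (at 0)"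
    by (rule has_derivative_compose[where g = f and f = "\<lambda>t. x + t *\<^sub>R h"])
       (use assms in \<open>auto intro!: derivative_eq_intros\<close>)
  moreover have "f' (s *\<^sub>R h) = s *\<^sub>R f' h" for s
    by (rule linear_scale[OF has_derivative_linear, OF assms])
  ultimately have "((\<lambda>t. f (x + t *\<^sub>R h)) has_derivative (\<lambda>s. s *\<^sub>R f' h)) (at 0)"
    by simp
  then have a: "((\<lambda>t. norm ((1 / norm (t - 0)) *\<^sub>R (f (x + t *\<^sub>R h) - (f (x + 0 *\<^sub>R h) + (t - 0) *\<^sub>R f' h)))) \<longlongrightarrow> 0) (at 0)"
    unfolding has_derivative_at2 by (elim conjE) (rule tendsto_norm_zero)
  have b: "norm ((1 / norm (t - 0)) *\<^sub>R (f (x + t *\<^sub>R h) - (f (x + 0 *\<^sub>R h) + (t - 0) *\<^sub>R f' h)))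
      = norm ((1 / t) *\<^sub>R (f (x + t *\<^sub>R h) - f x) - f' h)" if "t \<noteq> 0" for t
  proof -
    have "(1 / t) *\<^sub>R (f (x + t *\<^sub>R h) - f x) - f' h = (1 / t) *\<^sub>R (f (x + t *\<^sub>R h) - (f x + t *\<^sub>R f' h))"
      using that by (simp add: scaleR_diff_right scaleR_add_right)
    then show ?thesis by simp
  qed
  have "((\<lambda>t. norm ((1 / t) *\<^sub>R (f (x + t *\<^sub>R h) - f x) - f' h)) \<longlongrightarrow> 0) (at 0)"
    by (rule Lim_transform_eventually[OF a]) (use b in \<open>simp add: eventually_at_filter\<close>)
  then have lim: "((\<lambda>t. (1 / t) *\<^sub>R (f (x + t *\<^sub>R h) - f x)) \<longlongrightarrow> f' h) (at 0)"
    by (rule LIM_zero_cancel[OF tendsto_norm_zero_cancel])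
  have "filterlim (\<lambda>n. inverse (real (Suc n))) (at 0) sequentially"
    using LIMSEQ_inverse_real_of_nat by (auto simp: filterlim_at)
  from filterlim_compose[OF lim this] show ?thesis
    by (simp only: inverse_inverse_eq divide_inverse mult_1_left)
qed

text \<open>Translation invariance makes the integral of every difference quotient vanish.\<close>
lemma integral_directional_derivative_eq_0:
  fixes f :: "'a::euclidean_space \<Rightarrow> 'b::{banach, second_countable_topology}"
  assumes der: "\<And>x. (f has_derivative f' x) (at x)"
    and cont: "continuous_on UNIV (\<lambda>x. f' x h)"
    and supp: "\<And>x. R < norm x \<Longrightarrow> f x = 0"
  shows "(\<integral>x. f' x h \<partial>lborel) = 0"
proof -
  define q where "q n x = real (Suc n) *\<^sub>R (f (x + inverse (real (Suc n)) *\<^sub>R h) - f x)" for n x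
  have contf: "continuous_on UNIV f"
    by (intro continuous_at_imp_continuous_on ballI has_derivative_continuous[OF der])
  then have [measurable]: "f \<in> borel_measurable borel"
    by (rule borel_measurable_continuous_onI)
  have qlim: "(\<lambda>n. q n x) \<longlonglongrightarrow> f' x h" for x
    unfolding q_def by (rule directional_difference_quotient[OF der])
  \<comment> \<open>No increment is longer than \<open>h\<close>, so all quotients vanish outside
    one common ball.\<close>
  have q0: "q n x = 0" if "R + norm h < norm x" for n x
  proof -
    have "norm (inverse (real (Suc n)) *\<^sub>R h) \<le> norm h"
      by (auto intro!: mult_left_le_one_le simp: field_simps)
    moreover have "norm x \<le> norm (x + inverse (real (Suc n)) *\<^sub>R h) + norm (inverse (real (Suc n)) *\<^sub>R h)"
      using norm_triangle_ineq4[of "x + inverse (real (Suc n)) *\<^sub>R h" "inverse (real (Suc n)) *\<^sub>R h"] by simp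
    ultimately have "R < norm (x + inverse (real (Suc n)) *\<^sub>R h)" "R < norm x"
      using that norm_ge_zero[of h] by linarith+
    then show ?thesis by (simp add: q_def supp)
  qed
  have f'0: "f' x h = 0" if "R + norm h < norm x" for x
    using LIMSEQ_unique[OF qlim[of x], of 0] q0[OF that] by simp
  obtain B where B: "B > 0" "\<And>x. norm (f' x h) \<le> B"
    using bounded_continuous_bounded_support[OF cont, of "R + norm h"] f'0 by metis
  have qB: "norm (q n x) \<le> B" for n x
  proof -
    have "norm (q n x) = real (Suc n) * norm (f (x + inverse (real (Suc n)) *\<^sub>R h) - f x)"
      unfolding q_def by simp
    also have "\<dots> \<le> real (Suc n) * (B * \<bar>inverse (real (Suc n))\<bar>)"
      by (intro mult_left_mono norm_directional_increment_le[OF der B(2)]) auto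
    also have "\<dots> = B" by (simp add: field_simps)
    finally show ?thesis .
  qed
  have "(\<lambda>n. \<integral>x. q n x \<partial>lborel) \<longlonglongrightarrow> (\<integral>x. f' x h \<partial>lborel)"
  proof (rule integral_dominated_convergence)
    show "(\<lambda>x. f' x h) \<in> borel_measurable lborel"
      using borel_measurable_continuous_onI[OF cont] by simp
    show "q n \<in> borel_measurable lborel" for n
      unfolding q_def by measurable
    have "integrable lborel (indicat_real (cball (0::'a) (R + norm h)))"
      using emeasure_bounded_finite[OF bounded_cball[of "0::'a" "R + norm h"]]
      by (intro integrable_real_indicator) auto
    then show "integrable lborel (\<lambda>x. B * indicat_real (cball (0::'a) (R + norm h)) x)"
      by simp
    show "AE x in lborel. norm (q n x) \<le> B * indicat_real (cball 0 (R + norm h)) x" for n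
      using qB q0 by (auto simp: indicator_def not_le)
  qed (use qlim in auto)
  moreover have "(\<integral>x. q n x \<partial>lborel) = 0" for n
  proof -
    have "integrable lborel f"
      by (rule integrable_continuous_bounded_support[OF contf supp])
    moreover have "integrable lborel (\<lambda>x. f (x + a))" for a
    proof (rule integrable_continuous_bounded_support)
      show "continuous_on UNIV (\<lambda>x. f (x + a))"
        by (rule continuous_on_compose2[OF contf]) (auto intro!: continuous_intros)
      show "f (x + a) = 0" if "R + norm a < norm x" for x
        using that norm_triangle_ineq4[of "x + a" a] by (intro supp) simp
    qed
    ultimately show ?thesis
      unfolding q_def by (simp add: lborel_integral_translate)
  qed
  ultimately show ?thesis by (simp add: LIMSEQ_const_iff)
qed

text \<open>\<open>Ck_on\<close> hides the derivative behind an existential quantifier at every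
  level; uniqueness of derivatives transfers the regularity to whichever derivative is at
  hand.\<close>

lemma Ck_on_Suc_directional:
  assumes "Ck_on (Suc k) UNIV f" "\<And>x. (f has_derivative f' x) (at x)"
  shows "Ck_on k UNIV (\<lambda>x. f' x h)"
proof -
  from assms(1) obtain g where g: "\<And>x. (f has_derivative g x) (at x)" "\<And>h. Ck_on k UNIV (\<lambda>x. g x h)"
    by auto
  have "f' = g" using has_derivative_unique[OF assms(2) g(1)] by auto
  then show ?thesis using g by simp
qed

lemma Ck_on_diff:
  "Ck_on k S f \<Longrightarrow> Ck_on k S g \<Longrightarrow> Ck_on k S (\<lambda>x. f x - g x)"
proof (induction k arbitrary: f g)
  case 0
  then show ?case by (auto intro: continuous_on_diff)
next
  case (Suc k)
  from Suc.prems obtain f' g' where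
    "\<And>x. x \<in> S \<Longrightarrow> (f has_derivative f' x) (at x)" "\<And>h. Ck_on k S (\<lambda>x. f' x h)"
    "\<And>x. x \<in> S \<Longrightarrow> (g has_derivative g' x) (at x)" "\<And>h. Ck_on k S (\<lambda>x. g' x h)"
    unfolding Ck_on.simps by metis
  then show ?case
    using Suc.IH unfolding Ck_on.simps
    by (intro exI[of _ "\<lambda>x h. f' x h - g' x h"] conjI ballI allI has_derivative_diff) blast+
qed

lemma test_function_boundE:
  assumes "test_function u"
  obtains R where "\<And>x. R < norm x \<Longrightarrow> u x = 0"
proof -
  have "bounded {x. u x \<noteq> 0}"
    using assms by (auto simp: test_function_def supp_def)
  then obtain R where "\<And>x. u x \<noteq> 0 \<Longrightarrow> norm x \<le> R" unfolding bounded_iff by auto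
  then show thesis using that[of R] by (meson not_le)
qed

lemma test_function_continuous: "test_function u \<Longrightarrow> continuous_on S u"
  using continuous_on_subset[OF _ subset_UNIV] Ck_on.simps(1)[of UNIV u]
  unfolding test_function_def smooth_on_def by blast

lemma test_function_measurable: "test_function u \<Longrightarrow> u \<in> borel_measurable borel"
  by (intro borel_measurable_continuous_onI test_function_continuous)

lemma test_function_integrable: "test_function u \<Longrightarrow> integrable lborel u"
  by (rule test_function_boundE[of u], assumption)
     (rule integrable_continuous_bounded_support[OF test_function_continuous])

lemma test_function_diff:
  assumes "test_function u" "test_function v"
  shows "test_function (\<lambda>x. u x - v x)"
proof -
  have "supp (\<lambda>x. u x - v x) \<subseteq> supp u \<union> supp v"
    unfolding supp_def closure_Un[symmetric] by (rule closure_mono) auto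
  moreover have "compact (supp u \<union> supp v)"
    using assms by (auto simp: test_function_def)
  ultimately have "compact (supp (\<lambda>x. u x - v x))"
    by (metis Int_absorb1 closed_closure compact_Int_closed supp_def)
  then show ?thesis using assms by (auto simp: test_function_def smooth_on_def Ck_on_diff)
qed

text \<open>On the open complement of the support \<open>u\<close> is locally constant zero, so the
  derivative vanishes there and no directional derivative enlarges the support.\<close>

lemma test_function_derivativeE:
  assumes "test_function u"
  obtains u' where "\<And>x. (u has_derivative u' x) (at x)" "\<And>h. test_function (\<lambda>x. u' x h)"
proof -
  have "Ck_on (Suc 0) UNIV u" using assms unfolding test_function_def smooth_on_def by blast
  then obtain u' where u': "\<And>x. (u has_derivative u' x) (at x)" by auto
  have "test_function (\<lambda>x. u' x h)" for h
  proof -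
    have "u' x h = 0" if "x \<notin> supp u" for x
    proof -
      have "((\<lambda>_. 0) has_derivative u' x) (at x)"
        by (rule has_derivative_transform_within_open[OF u', where s = "- supp u"])
           (use that closure_subset[of "{x. u x \<noteq> 0}"] in \<open>auto simp: supp_def\<close>)
      then have "u' x = (\<lambda>_. 0)" using has_derivative_unique has_derivative_const by blast
      then show ?thesis by simp
    qed
    then have "supp (\<lambda>x. u' x h) \<subseteq> supp u"
      unfolding supp_def[of "\<lambda>x. u' x h"] by (intro closure_minimal) (auto simp: supp_def)
    then have "compact (supp (\<lambda>x. u' x h))"
      using assms compact_Int_closed[of "supp u" "supp (\<lambda>x. u' x h)"]
      by (auto simp: test_function_def supp_def Int_absorb1)
    then show ?thesis
      using assms Ck_on_Suc_directional[OF _ u'] by (auto simp: test_function_def smooth_on_def)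
  qed
  with u' show thesis by (rule that)
qed

section \<open>Decay of the Fourier transform\<close>

lemma norm_fourier_kernel [simp]: "norm (exp (- 2 * pi * \<i> * of_real a)) = 1"
  by (simp add: norm_exp_eq_Re)

lemma fourier_kernel_integrable:
  fixes f :: "'a::euclidean_space \<Rightarrow> complex"
  assumes "integrable lborel f"
  shows "integrable lborel (\<lambda>x. f x * exp (- 2 * pi * \<i> * of_real (x \<bullet> \<xi>)))"
  by (rule Bochner_Integration.integrable_bound[OF assms])
     (use borel_measurable_integrable[OF assms] in \<open>auto simp: norm_mult simp del: of_real_mult\<close>)

lemma fourier_measurable [measurable]:
  fixes f :: "'a::euclidean_space \<Rightarrow> complex"
  assumes [measurable]: "f \<in> borel_measurable borel"
  shows "fourier f \<in> borel_measurable borel"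
proof -
  have "(\<lambda>\<xi>. \<integral>x. f x * exp (- 2 * pi * \<i> * of_real (x \<bullet> \<xi>)) \<partial>lborel) \<in> borel_measurable lborel"
    by measurable
  then show ?thesis by (simp add: fourier_def[abs_def])
qed

lemma norm_fourier_le:
  fixes f :: "'a::euclidean_space \<Rightarrow> complex"
  shows "norm (fourier f \<xi>) \<le> (\<integral>x. norm (f x) \<partial>lborel)"
  unfolding fourier_def by (rule order_trans[OF integral_norm_bound]) (simp add: norm_mult)

lemma fourier_diff:
  fixes f g :: "'a::euclidean_space \<Rightarrow> complex"
  assumes "integrable lborel f" "integrable lborel g"
  shows "fourier (\<lambda>x. f x - g x) \<xi> = fourier f \<xi> - fourier g \<xi>"
  unfolding fourier_def left_diff_distrib
  by (intro Bochner_Integration.integral_diff fourier_kernel_integrable assms)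

text \<open>Integration by parts: the derivative of \<open>u\<close> times the exponential kernel
  integrates to zero, and differentiating the kernel produces the factor in front of the
  transform.\<close>

lemma fourier_directional_derivative:
  fixes u :: "'a::euclidean_space \<Rightarrow> real"
  assumes u: "test_function u" and der: "\<And>x. (u has_derivative u' x) (at x)"
    and u': "test_function (\<lambda>x. u' x h)"
  shows "fourier (\<lambda>x. of_real (u' x h)) \<xi> = 2 * pi * \<i> * of_real (h \<bullet> \<xi>) * fourier (\<lambda>x. of_real (u x)) \<xi>"
proof -
  define c :: complex where "c = - 2 * pi * \<i>"
  define E where "E x = exp (c * of_real (x \<bullet> \<xi>))" for x
  define F where "F x = of_real (u x) * E x" for x
  define F' where "F' x k = of_real (u' x k) * E x + of_real (u x) * (c * of_real (k \<bullet> \<xi>) * E x)" for x k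
  obtain R where R: "\<And>x. R < norm x \<Longrightarrow> u x = 0" using test_function_boundE[OF u] by metis
  have E: "(E has_derivative (\<lambda>k. c * of_real (k \<bullet> \<xi>) * E x)) (at x)" for x
  proof -
    have "((\<lambda>x. c * of_real (x \<bullet> \<xi>)) has_derivative (\<lambda>k. c * of_real (k \<bullet> \<xi>))) (at x)"
      by (intro has_derivative_mult_right has_derivative_of_real has_derivative_inner_left has_derivative_ident)
    from has_derivative_compose[OF this DERIV_exp[unfolded has_field_derivative_def]]
    show ?thesis unfolding E_def by (simp add: mult.commute)
  qed
  have contE: "continuous_on UNIV E" unfolding E_def by (intro continuous_intros)
  have int: "integrable lborel (\<lambda>x. of_real (v x) * E x)" if "test_function v" for v :: "'a \<Rightarrow> real"
    using fourier_kernel_integrable[of "\<lambda>x. of_real (v x)" \<xi>] test_function_integrable[OF that]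
    by (simp add: E_def c_def)
  have "(\<integral>x. F' x h \<partial>lborel) = 0"
  proof (rule integral_directional_derivative_eq_0[where f = F])
    show "(F has_derivative F' x) (at x)" for x
      unfolding F_def F'_def
      by (rule derivative_eq_intros E has_derivative_of_real der refl)+ (simp add: algebra_simps)
    show "continuous_on UNIV (\<lambda>x. F' x h)"
      unfolding F'_def by (intro continuous_intros contE test_function_continuous u u')
    show "R < norm x \<Longrightarrow> F x = 0" for x by (simp add: F_def R)
  qed
  also have "(\<lambda>x. F' x h) = (\<lambda>x. of_real (u' x h) * E x + (c * of_real (h \<bullet> \<xi>)) * (of_real (u x) * E x))"
    by (simp add: F'_def fun_eq_iff algebra_simps)
  also have "(\<integral>x. of_real (u' x h) * E x + (c * of_real (h \<bullet> \<xi>)) * (of_real (u x) * E x) \<partial>lborel)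
    = (\<integral>x. of_real (u' x h) * E x \<partial>lborel) + (c * of_real (h \<bullet> \<xi>)) * (\<integral>x. of_real (u x) * E x \<partial>lborel)"
    using int[OF u] int[OF u'] by simp
  finally show ?thesis by (simp add: fourier_def E_def c_def eq_neg_iff_add_eq_0)
qed

text \<open>\<open>v\<close> is \<open>u\<close> minus its second derivative in direction
  \<open>b\<close>: two derivatives multiply the transform by the square of
  \<open>2 * pi * \<i> * (b \<bullet> \<xi>)\<close>, which is negative.\<close>

lemma test_function_fourier_weight:
  fixes u :: "'a::euclidean_space \<Rightarrow> real"
  assumes u: "test_function u"
  obtains v where "test_function v"
    "\<And>\<xi>. fourier (\<lambda>x. of_real (v x)) \<xi> = of_real (1 + (2 * pi * (b \<bullet> \<xi>))\<^sup>2) * fourier (\<lambda>x. of_real (u x)) \<xi>"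
proof -
  obtain u' where u': "\<And>x. (u has_derivative u' x) (at x)" "\<And>h. test_function (\<lambda>x. u' x h)"
    using test_function_derivativeE[OF u] by metis
  obtain u'' where u'': "\<And>x. ((\<lambda>x. u' x b) has_derivative u'' x) (at x)" "\<And>h. test_function (\<lambda>x. u'' x h)"
    using test_function_derivativeE[OF u'(2)] by metis
  have "fourier (\<lambda>x. of_real (u'' x b)) \<xi> = - of_real ((2 * pi * (b \<bullet> \<xi>))\<^sup>2) * fourier (\<lambda>x. of_real (u x)) \<xi>" for \<xi>
    unfolding fourier_directional_derivative[OF u'(2) u''] fourier_directional_derivative[OF u u']
    by (simp add: power2_eq_square)
  then have "fourier (\<lambda>x. of_real (u x - u'' x b)) \<xi> = of_real (1 + (2 * pi * (b \<bullet> \<xi>))\<^sup>2) * fourier (\<lambda>x. of_real (u x)) \<xi>" for \<xi>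
    using test_function_integrable[OF u] test_function_integrable[OF u''(2), of b]
    by (simp add: fourier_diff algebra_simps)
  then show thesis using that[OF test_function_diff[OF u u''(2)]] by blast
qed

text \<open>Meant for \<open>B = Basis\<close>. A product over coordinates is preferred to a power
  of \<open>1 + (norm \<xi>)\<^sup>2\<close> because its reciprocal separates the variables and
  reduces integrability to one dimension.\<close>

lemma test_function_fourier_weight_prod:
  fixes u :: "'a::euclidean_space \<Rightarrow> real"
  assumes u: "test_function u" and "finite B"
  shows "\<exists>v. test_function v \<and>
    (\<forall>\<xi>. fourier (\<lambda>x. of_real (v x)) \<xi> = of_real (\<Prod>b\<in>B. 1 + (2 * pi * (b \<bullet> \<xi>))\<^sup>2) * fourier (\<lambda>x. of_real (u x)) \<xi>)"
  using \<open>finite B\<close>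
proof induction
  case empty
  then show ?case using u by auto
next
  case (insert b B)
  then obtain v where v: "test_function v"
    "\<And>\<xi>. fourier (\<lambda>x. of_real (v x)) \<xi> = of_real (\<Prod>b\<in>B. 1 + (2 * pi * (b \<bullet> \<xi>))\<^sup>2) * fourier (\<lambda>x. of_real (u x)) \<xi>"
    by blast
  obtain w where "test_function w"
    "\<And>\<xi>. fourier (\<lambda>x. of_real (w x)) \<xi> = of_real (1 + (2 * pi * (b \<bullet> \<xi>))\<^sup>2) * fourier (\<lambda>x. of_real (v x)) \<xi>"
    using test_function_fourier_weight[OF v(1), of b] by metis
  with v insert show ?case
    by (intro exI[of _ w]) (simp add: mult.assoc)
qed

text \<open>Lebesgue measure is the image of a product of one-dimensional ones, so functions that
  separate the variables integrate factor by factor. The general value type serves both the real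
  decay weights and the complex Gaussian kernels.\<close>

lemma
  fixes f :: "'a::euclidean_space \<Rightarrow> real \<Rightarrow> 'b::{real_normed_field,banach,second_countable_topology}"
  assumes f: "\<And>b. b \<in> Basis \<Longrightarrow> integrable lborel (f b)"
  shows integrable_prod_Basis: "integrable lborel (\<lambda>x. \<Prod>b\<in>Basis. f b (x \<bullet> b))"
    and integral_prod_Basis: "(\<integral>x. (\<Prod>b\<in>Basis. f b (x \<bullet> b)) \<partial>lborel) = (\<Prod>b\<in>Basis. \<integral>x. f b x \<partial>lborel)"
proof -
  interpret product_sigma_finite "\<lambda>_::'a. lborel :: real measure" ..
  have [measurable]: "b \<in> Basis \<Longrightarrow> f b \<in> borel_measurable borel" for b using f[of b] by simp
  have eq: "(\<Prod>b\<in>Basis. f b ((\<Sum>c\<in>Basis. x c *\<^sub>R c) \<bullet> b)) = (\<Prod>b\<in>Basis. f b (x b))" for x :: "'a \<Rightarrow> real"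
    by (intro prod.cong refl) simp
  show "integrable lborel (\<lambda>x. \<Prod>b\<in>Basis. f b (x \<bullet> b))"
    by (subst lborel_eq, subst integrable_distr_eq) (simp_all add: eq product_integrable_prod f)
  show "(\<integral>x. (\<Prod>b\<in>Basis. f b (x \<bullet> b)) \<partial>lborel) = (\<Prod>b\<in>Basis. \<integral>x. f b x \<partial>lborel)"
    by (subst lborel_eq, subst integral_distr) (simp_all add: eq product_integral_prod f)
qed

text \<open>The transform of \<open>u\<close> is that of another test function, bounded by an
  integral norm, divided by a product of factors
  \<open>1 + (2 * pi * (b \<bullet> \<xi>))\<^sup>2\<close> whose reciprocals are integrable in each
  coordinate.\<close>

lemma fourier_test_function_integrable:
  fixes u :: "'a::euclidean_space \<Rightarrow> real"
  assumes u: "test_function u"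
  shows "integrable lborel (fourier (\<lambda>x. of_real (u x)))"
proof -
  obtain v where v: "test_function v" and
    "\<And>\<xi>. fourier (\<lambda>x. of_real (v x)) \<xi> = of_real (\<Prod>b\<in>Basis. 1 + (2 * pi * (b \<bullet> \<xi>))\<^sup>2) * fourier (\<lambda>x. of_real (u x)) \<xi>"
    using test_function_fourier_weight_prod[OF u finite_Basis] by blast
  moreover have "(\<Prod>b\<in>Basis. inverse (1 + (2 * pi * (\<xi> \<bullet> b))\<^sup>2)) * (\<Prod>b\<in>Basis. 1 + (2 * pi * (b \<bullet> \<xi>))\<^sup>2) = 1" for \<xi> :: 'a
  proof -
    have "inverse (1 + (2 * pi * (\<xi> \<bullet> b))\<^sup>2) * (1 + (2 * pi * (b \<bullet> \<xi>))\<^sup>2) = 1" for b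
      unfolding inner_commute[of \<xi>]
      using add_pos_nonneg[OF zero_less_one zero_le_power2, of "2 * pi * (b \<bullet> \<xi>)"] by (intro left_inverse) simp
    then show ?thesis by (simp add: prod.distrib[symmetric])
  qed
  ultimately have uv: "fourier (\<lambda>x. of_real (u x)) \<xi>
      = of_real (\<Prod>b\<in>Basis. inverse (1 + (2 * pi * (\<xi> \<bullet> b))\<^sup>2)) * fourier (\<lambda>x. of_real (v x)) \<xi>" for \<xi>
    by (simp only: mult.assoc[symmetric] of_real_mult[symmetric] of_real_1 mult_1)
  define C where "C = (\<integral>x. \<bar>v x\<bar> \<partial>lborel)"
  have C: "norm (fourier (\<lambda>x. of_real (v x)) \<xi>) \<le> C" for \<xi>
    using norm_fourier_le[of "\<lambda>x. of_real (v x)" \<xi>] by (simp add: C_def)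
  have "integrable lborel (\<lambda>x::real. inverse (1 + x\<^sup>2))"
    using integrable_inverse_1_plus_square by (simp add: set_integrable_def einterval_eq)
  then have "integrable lborel (\<lambda>x::real. inverse (1 + (0 + 2 * pi * x)\<^sup>2))"
    by (rule lborel_integrable_real_affine) simp
  then have "integrable lborel (\<lambda>\<xi>::'a. \<Prod>b\<in>Basis. inverse (1 + (2 * pi * (\<xi> \<bullet> b))\<^sup>2))"
    by (intro integrable_prod_Basis[of "\<lambda>_ x. inverse (1 + (2 * pi * x)\<^sup>2)"]) simp
  then have "integrable lborel (\<lambda>\<xi>::'a. C * (\<Prod>b\<in>Basis. inverse (1 + (2 * pi * (\<xi> \<bullet> b))\<^sup>2)))"
    by simp
  then show ?thesis
  proof (rule Bochner_Integration.integrable_bound)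
    show "fourier (\<lambda>x. of_real (u x)) \<in> borel_measurable lborel"
      using test_function_measurable[OF u] by simp
    have "norm (fourier (\<lambda>x. of_real (u x)) \<xi>) \<le> C * (\<Prod>b\<in>Basis. inverse (1 + (2 * pi * (\<xi> \<bullet> b))\<^sup>2))" for \<xi>
      unfolding uv norm_mult norm_of_real mult.commute[of C]
      by (subst abs_of_nonneg) (auto intro!: prod_nonneg mult_left_mono C)
    moreover have "0 \<le> C" by (simp add: C_def)
    ultimately show "AE \<xi> in lborel. norm (fourier (\<lambda>x. of_real (u x)) \<xi>)
        \<le> norm (C * (\<Prod>b\<in>Basis. inverse (1 + (2 * pi * (\<xi> \<bullet> b))\<^sup>2)))"
      by (simp add: prod_nonneg)
  qed
qed

text \<open>Up to the constant \<open>2 * pi * \<i>\<close> this is the transform of a directional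
  derivative of \<open>u\<close>, again a test function.\<close>

lemma fourier_test_function_integrable_inner:
  fixes u :: "'a::euclidean_space \<Rightarrow> real"
  assumes u: "test_function u"
  shows "integrable lborel (\<lambda>\<xi>. of_real (h \<bullet> \<xi>) * fourier (\<lambda>x. of_real (u x)) \<xi>)"
proof -
  obtain u' where u': "\<And>x. (u has_derivative u' x) (at x)" "\<And>h. test_function (\<lambda>x. u' x h)"
    using test_function_derivativeE[OF u] by metis
  have "integrable lborel (\<lambda>\<xi>. (1 / (2 * pi * \<i>)) * fourier (\<lambda>x. of_real (u' x h)) \<xi>)"
    using fourier_test_function_integrable[OF u'(2)] by (rule integrable_mult_right)
  then show ?thesis unfolding fourier_directional_derivative[OF u u'] by simp
qed

section \<open>Gaussians and the multiplication formula\<close>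

text \<open>Rescaling turns the integral into the characteristic function of the standard normal
  distribution.\<close>

lemma
  fixes c y :: real
  assumes c: "c > 0"
  shows integrable_gaussian_real: "integrable lborel (\<lambda>x::real. of_real (exp (- (c * x\<^sup>2))) * exp (- 2 * pi * \<i> * of_real (x * y)))"
    and integral_gaussian_real:
      "(\<integral>x. of_real (exp (- (c * x\<^sup>2))) * exp (- 2 * pi * \<i> * of_real (x * y)) \<partial>lborel)
       = of_real (sqrt (pi / c) * exp (- (pi\<^sup>2 / c * y\<^sup>2)))"
proof -
  \<comment> \<open>The scale with \<open>c * k\<^sup>2 = 1 / 2\<close>, which produces the exponent
    of the standard normal density.\<close>
  define k where "k = 1 / sqrt (2 * c)"
  have k: "k > 0" and k2: "c * k\<^sup>2 = 1 / 2" using c by (auto simp: k_def power_divide)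
  define G :: "real \<Rightarrow> complex" where "G x = of_real (exp (- (c * x\<^sup>2))) * exp (- 2 * pi * \<i> * of_real (x * y))" for x
  define t where "t = - (2 * pi * k * y)"
  have G: "G (0 + k * z) = of_real (sqrt (2 * pi)) * (of_real (std_normal_density z) * iexp (t * z))" for z
  proof -
    have "c * (k * z)\<^sup>2 = z\<^sup>2 / 2" using k2 by (simp add: power_mult_distrib mult.assoc[symmetric])
    then show ?thesis
      by (simp add: G_def t_def std_normal_density_def algebra_simps)
  qed
  have int: "integrable lborel (\<lambda>z. of_real (std_normal_density z) * iexp (t * z))"
  proof (rule Bochner_Integration.integrable_bound[of _ std_normal_density])
    show "integrable lborel std_normal_density"
      using integrable_std_normal_moment[of 0] by simp
  qed (auto simp: norm_mult)
  then have int': "integrable lborel (\<lambda>z. G (0 + k * z))" unfolding G by (rule integrable_mult_right)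
  show "integrable lborel G"
    using int' k by (subst (asm) lborel_integrable_real_affine_iff) auto
  have "(\<integral>z. of_real (std_normal_density z) * iexp (t * z) \<partial>lborel) = char std_normal_distribution t"
    unfolding char_def by (subst integral_density) (auto simp: scaleR_conv_of_real)
  also have "\<dots> = of_real (exp (- (t\<^sup>2) / 2))" by (simp add: char_std_normal_distribution)
  finally have ch: "(\<integral>z. of_real (std_normal_density z) * iexp (t * z) \<partial>lborel) = of_real (exp (- (t\<^sup>2) / 2))" .
  have "integral\<^sup>L lborel G = \<bar>k\<bar> *\<^sub>R (\<integral>z. G (0 + k * z) \<partial>lborel)"
    using k by (intro lborel_integral_real_affine) simp
  also have "\<dots> = of_real (k * sqrt (2 * pi) * exp (- (t\<^sup>2) / 2))"
    unfolding G using ch k by (simp add: scaleR_conv_of_real)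
  also have "k * sqrt (2 * pi) = sqrt (pi / c)"
    using c by (simp add: k_def real_sqrt_divide real_sqrt_mult)
  also have "- (t\<^sup>2) / 2 = - (pi\<^sup>2 / c * y\<^sup>2)"
    using c by (simp add: t_def k_def power_mult_distrib power_divide)
  finally show "integral\<^sup>L lborel G = of_real (sqrt (pi / c) * exp (- (pi\<^sup>2 / c * y\<^sup>2)))" .
qed

text \<open>The exponent and the phase are both sums over coordinates, so the kernel is a product of
  one-dimensional kernels.\<close>

lemma
  fixes y :: "'a::euclidean_space"
  assumes c: "c > 0"
  shows integrable_gaussian_kernel: "integrable lborel (\<lambda>x::'a. of_real (exp (- (c * (norm x)\<^sup>2))) * exp (- 2 * pi * \<i> * of_real (x \<bullet> y)))"
    and fourier_gaussian:
      "fourier (\<lambda>x::'a. of_real (exp (- (c * (norm x)\<^sup>2)))) y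
       = of_real (sqrt (pi / c) ^ DIM('a) * exp (- (pi\<^sup>2 / c * (norm y)\<^sup>2)))"
proof -
  have sq: "(norm x)\<^sup>2 = (\<Sum>b\<in>Basis. (x \<bullet> b)\<^sup>2)" for x :: 'a
    by (subst power2_norm_eq_inner, subst euclidean_inner) (simp add: power2_eq_square)
  have eq: "of_real (exp (- (c * (norm x)\<^sup>2))) * exp (- 2 * pi * \<i> * of_real (x \<bullet> y))
    = (\<Prod>b\<in>Basis. of_real (exp (- (c * (x \<bullet> b)\<^sup>2))) * exp (- 2 * pi * \<i> * of_real ((x \<bullet> b) * (y \<bullet> b))))" for x :: 'a
    unfolding sq by (subst (1) euclidean_inner[of x y])
      (simp add: sum_distrib_left exp_sum prod.distrib sum_negf[symmetric] del: of_real_mult)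
  show "integrable lborel (\<lambda>x::'a. of_real (exp (- (c * (norm x)\<^sup>2))) * exp (- 2 * pi * \<i> * of_real (x \<bullet> y)))"
    unfolding eq
    by (rule integrable_prod_Basis[of "\<lambda>b t. of_real (exp (- (c * t\<^sup>2))) * exp (- 2 * pi * \<i> * of_real (t * (y \<bullet> b)))"])
       (rule integrable_gaussian_real[OF c])
  have "fourier (\<lambda>x::'a. of_real (exp (- (c * (norm x)\<^sup>2)))) y
     = (\<Prod>b\<in>Basis. \<integral>t. of_real (exp (- (c * t\<^sup>2))) * exp (- 2 * pi * \<i> * of_real (t * (y \<bullet> b))) \<partial>lborel)"
    unfolding fourier_def eq
    by (rule integral_prod_Basis[of "\<lambda>b t. of_real (exp (- (c * t\<^sup>2))) * exp (- 2 * pi * \<i> * of_real (t * (y \<bullet> b)))"])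
       (rule integrable_gaussian_real[OF c])
  also have "\<dots> = (\<Prod>b\<in>Basis. of_real (sqrt (pi / c) * exp (- (pi\<^sup>2 / c * (y \<bullet> b)\<^sup>2))))"
    by (intro prod.cong refl integral_gaussian_real[OF c])
  also have "\<dots> = of_real (sqrt (pi / c) ^ DIM('a) * exp (- (pi\<^sup>2 / c * (norm y)\<^sup>2)))"
    unfolding sq by (simp only: of_real_prod[symmetric] prod.distrib prod_constant sum_distrib_left sum_negf[symmetric] exp_sum[OF finite_Basis])
  finally show "fourier (\<lambda>x::'a. of_real (exp (- (c * (norm x)\<^sup>2)))) y
       = of_real (sqrt (pi / c) ^ DIM('a) * exp (- (pi\<^sup>2 / c * (norm y)\<^sup>2)))" .
qed

text \<open>Fubini for a kernel symmetric in \<open>x\<close> and \<open>\<xi>\<close>. Used to move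
  the transform from a test function onto a Gaussian, so that no inversion theorem enters.\<close>

lemma integral_fourier_mult:
  fixes f g :: "'a::euclidean_space \<Rightarrow> complex"
  assumes f: "integrable lborel f" and g: "integrable lborel g"
  shows "(\<integral>\<xi>. fourier f \<xi> * g \<xi> \<partial>lborel) = (\<integral>x. f x * fourier g x \<partial>lborel)"
proof -
  have [measurable]: "f \<in> borel_measurable borel" "g \<in> borel_measurable borel"
    using f g by auto
  have "integrable (lborel \<Otimes>\<^sub>M lborel) (\<lambda>(x, \<xi>). f x * g \<xi> * exp (- 2 * pi * \<i> * of_real (x \<bullet> \<xi>)))"
  proof (rule lborel_pair.Fubini_integrable)
    show "(\<lambda>(x, \<xi>). f x * g \<xi> * exp (- 2 * pi * \<i> * of_real (x \<bullet> \<xi>))) \<in> borel_measurable (lborel \<Otimes>\<^sub>M lborel)"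
      by measurable
    have "integrable lborel (\<lambda>x. norm (f x) * (\<integral>\<xi>. norm (g \<xi>) \<partial>lborel))"
      using f by simp
    then show "integrable lborel (\<lambda>x. \<integral>\<xi>. norm (case (x, \<xi>) of (x, \<xi>) \<Rightarrow> f x * g \<xi> * exp (- 2 * pi * \<i> * of_real (x \<bullet> \<xi>))) \<partial>lborel)"
      by (simp only: prod.case norm_mult norm_fourier_kernel mult_1_right integral_mult_right_zero)
    show "AE x in lborel. integrable lborel (\<lambda>\<xi>. case (x, \<xi>) of (x, \<xi>) \<Rightarrow> f x * g \<xi> * exp (- 2 * pi * \<i> * of_real (x \<bullet> \<xi>)))"
    proof (rule AE_I2)
      fix x :: 'a
      have "integrable lborel (\<lambda>\<xi>. f x * (g \<xi> * exp (- 2 * pi * \<i> * of_real (\<xi> \<bullet> x))))"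
        by (intro integrable_mult_right fourier_kernel_integrable g)
      then show "integrable lborel (\<lambda>\<xi>. case (x, \<xi>) of (x, \<xi>) \<Rightarrow> f x * g \<xi> * exp (- 2 * pi * \<i> * of_real (x \<bullet> \<xi>)))"
        by (simp add: inner_commute mult.assoc)
    qed
  qed
  then have *: "(\<integral>\<xi>. (\<integral>x. f x * g \<xi> * exp (- 2 * pi * \<i> * of_real (x \<bullet> \<xi>)) \<partial>lborel) \<partial>lborel)
     = (\<integral>x. (\<integral>\<xi>. f x * g \<xi> * exp (- 2 * pi * \<i> * of_real (x \<bullet> \<xi>)) \<partial>lborel) \<partial>lborel)"
    by (rule lborel_pair.Fubini_integral)
  have "(\<integral>x. f x * g \<xi> * exp (- 2 * pi * \<i> * of_real (x \<bullet> \<xi>)) \<partial>lborel) = fourier f \<xi> * g \<xi>" for \<xi>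
    unfolding fourier_def by (subst integral_mult_left_zero[symmetric]) (simp add: mult_ac)
  moreover have "(\<integral>\<xi>. f x * g \<xi> * exp (- 2 * pi * \<i> * of_real (x \<bullet> \<xi>)) \<partial>lborel) = f x * fourier g x" for x
    unfolding fourier_def by (subst integral_mult_right_zero[symmetric]) (simp add: mult_ac inner_commute)
  ultimately show ?thesis using * by simp
qed

section \<open>Gaussian moments\<close>

text \<open>Integration by parts: the derivative of the Gaussian in direction \<open>h\<close> is
  \<open>- 2 * k * (h \<bullet> x)\<close> times itself. The sign of \<open>k\<close> is free
  because \<open>u\<close> has bounded support.\<close>

lemma integral_gaussian_directional_derivative:
  fixes u :: "'a::euclidean_space \<Rightarrow> real"
  assumes u: "test_function u" and der: "\<And>x. (u has_derivative u' x) (at x)"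
    and u': "test_function (\<lambda>x. u' x h)"
  shows "(\<integral>x. u' x h * exp (- (k * (norm x)\<^sup>2)) \<partial>lborel) = 2 * k * (\<integral>x. exp (- (k * (norm x)\<^sup>2)) * ((h \<bullet> x) * u x) \<partial>lborel)"
proof -
  obtain R where R: "\<And>x. R < norm x \<Longrightarrow> u x = 0" using test_function_boundE[OF u] by metis
  obtain R' where R': "\<And>x. R' < norm x \<Longrightarrow> u' x h = 0" using test_function_boundE[OF u'] by metis
  define G where "G x = exp (- (k * (x \<bullet> x)))" for x :: 'a
  have G: "(G has_derivative (\<lambda>j. - (2 * k * (j \<bullet> x)) * G x)) (at x)" for x
    unfolding G_def by (auto intro!: derivative_eq_intros simp: inner_commute algebra_simps)
  have contG: "continuous_on UNIV G" unfolding G_def by (intro continuous_intros)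
  have "(\<integral>x. u' x h * G x + u x * (- (2 * k * (h \<bullet> x)) * G x) \<partial>lborel) = 0"
  proof (rule integral_directional_derivative_eq_0[where f = "\<lambda>x. u x * G x"])
    show "((\<lambda>x. u x * G x) has_derivative (\<lambda>j. u' x j * G x + u x * (- (2 * k * (j \<bullet> x)) * G x))) (at x)" for x
      by (rule has_derivative_eq_rhs[OF has_derivative_mult[OF der G]]) (simp add: fun_eq_iff)
    show "continuous_on UNIV (\<lambda>x. u' x h * G x + u x * (- (2 * k * (h \<bullet> x)) * G x))"
      by (intro continuous_intros contG test_function_continuous u u')
    show "R < norm x \<Longrightarrow> u x * G x = 0" for x by (simp add: R)
  qed
  also have "(\<lambda>x. u' x h * G x + u x * (- (2 * k * (h \<bullet> x)) * G x)) = (\<lambda>x. u' x h * G x - 2 * k * (G x * ((h \<bullet> x) * u x)))"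
    by (simp add: fun_eq_iff algebra_simps)
  also have "integral\<^sup>L lborel \<dots> = (\<integral>x. u' x h * G x \<partial>lborel) - 2 * k * (\<integral>x. G x * ((h \<bullet> x) * u x) \<partial>lborel)"
  proof -
    have "integrable lborel (\<lambda>x. u' x h * G x)"
      by (rule integrable_continuous_bounded_support[where R = R'])
         (auto intro!: continuous_intros contG test_function_continuous[OF u'] simp: R')
    moreover have "integrable lborel (\<lambda>x. G x * ((h \<bullet> x) * u x))"
      by (rule integrable_continuous_bounded_support[where R = R])
         (auto intro!: continuous_intros contG test_function_continuous[OF u] simp: R)
    ultimately show ?thesis by simp
  qed
  finally show ?thesis by (simp add: G_def power2_norm_eq_inner)
qed

text \<open>The multiplication formula is applied to the derivative of \<open>u\<close> in direction
  \<open>h\<close>. Its transform carries the factor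
  \<open>2 * pi * \<i> * (h \<bullet> \<xi>)\<close>, so the real part against a real Gaussian
  contains \<open>- 2 * pi\<close> times the moment of the imaginary part. On the other side
  integration by parts with \<open>k = pi\<^sup>2 / c\<close> yields
  \<open>2 * pi\<^sup>2 / c\<close> times the moment of \<open>u\<close>. The quotient of these
  constants is \<open>- pi / c\<close>; the remaining power comes from the transform of the
  Gaussian.\<close>

lemma gaussian_moment_fourier:
  fixes u :: "'a::euclidean_space \<Rightarrow> real"
  assumes u: "test_function u" and c: "c > 0"
  shows "(\<integral>\<xi>. exp (- (c * (norm \<xi>)\<^sup>2)) * ((h \<bullet> \<xi>) * Im (fourier (\<lambda>x. of_real (u x)) \<xi>)) \<partial>lborel)
    = - (sqrt (pi / c) ^ DIM('a) * (pi / c)) * (\<integral>x. exp (- (pi\<^sup>2 / c * (norm x)\<^sup>2)) * ((h \<bullet> x) * u x) \<partial>lborel)"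
proof -
  obtain u' where u': "\<And>x. (u has_derivative u' x) (at x)" "\<And>h. test_function (\<lambda>x. u' x h)"
    using test_function_derivativeE[OF u] by metis
  define g :: "'a \<Rightarrow> complex" where "g \<xi> = of_real (exp (- (c * (norm \<xi>)\<^sup>2)))" for \<xi>
  define J where "J = (\<integral>x. exp (- (pi\<^sup>2 / c * (norm x)\<^sup>2)) * ((h \<bullet> x) * u x) \<partial>lborel)"
  define F where "F = fourier (\<lambda>x. of_real (u x))"
  have g: "integrable lborel g"
    using integrable_gaussian_kernel[OF c, where y = "0::'a"] by (simp add: g_def[abs_def])
  have "(\<integral>\<xi>. fourier (\<lambda>x. of_real (u' x h)) \<xi> * g \<xi> \<partial>lborel) = (\<integral>x. of_real (u' x h) * fourier g x \<partial>lborel)"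
    by (rule integral_fourier_mult) (use g test_function_integrable[OF u'(2)] in auto)
  also have "\<dots> = (\<integral>x. of_real (sqrt (pi / c) ^ DIM('a) * (u' x h * exp (- (pi\<^sup>2 / c * (norm x)\<^sup>2)))) \<partial>lborel)"
    unfolding g_def[abs_def] fourier_gaussian[OF c] by (simp add: mult_ac)
  also have "\<dots> = of_real (\<integral>x. sqrt (pi / c) ^ DIM('a) * (u' x h * exp (- (pi\<^sup>2 / c * (norm x)\<^sup>2))) \<partial>lborel)"
    by (rule integral_complex_of_real)
  also have "\<dots> = of_real (sqrt (pi / c) ^ DIM('a) * (2 * (pi\<^sup>2 / c) * J))"
    by (simp only: integral_mult_right_zero integral_gaussian_directional_derivative[OF u u'] J_def)
  finally have "(\<integral>\<xi>. fourier (\<lambda>x. of_real (u' x h)) \<xi> * g \<xi> \<partial>lborel) = of_real (sqrt (pi / c) ^ DIM('a) * (2 * (pi\<^sup>2 / c) * J))" .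
  moreover have int: "integrable lborel (\<lambda>\<xi>. fourier (\<lambda>x. of_real (u' x h)) \<xi> * g \<xi>)"
    by (rule Bochner_Integration.integrable_bound[OF fourier_test_function_integrable[OF u'(2)[of h]]])
       (use g test_function_measurable[OF u'(2)] c in \<open>auto simp: norm_mult g_def intro!: mult_left_le\<close>)
  ultimately have "(\<integral>\<xi>. Re (fourier (\<lambda>x. of_real (u' x h)) \<xi> * g \<xi>) \<partial>lborel) = sqrt (pi / c) ^ DIM('a) * (2 * (pi\<^sup>2 / c) * J)"
    by (metis integral_Re Re_complex_of_real)
  moreover have "Re (fourier (\<lambda>x. of_real (u' x h)) \<xi> * g \<xi>) = (- (2 * pi)) * (exp (- (c * (norm \<xi>)\<^sup>2)) * ((h \<bullet> \<xi>) * Im (F \<xi>)))" for \<xi>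
    unfolding fourier_directional_derivative[OF u u'] g_def F_def[symmetric] by simp
  ultimately have "(- (2 * pi)) * (\<integral>\<xi>. exp (- (c * (norm \<xi>)\<^sup>2)) * ((h \<bullet> \<xi>) * Im (F \<xi>)) \<partial>lborel) = sqrt (pi / c) ^ DIM('a) * (2 * (pi\<^sup>2 / c) * J)"
    by simp
  also have "\<dots> = (- (2 * pi)) * (- (sqrt (pi / c) ^ DIM('a) * (pi / c)) * J)"
    by (simp add: power2_eq_square)
  finally show ?thesis unfolding F_def J_def by (subst (asm) mult_cancel_left) simp
qed

text \<open>The moments at parameters \<open>c\<close> and \<open>pi\<^sup>2 / c\<close> differ by a
  nonzero constant, and passing from \<open>c\<close> to \<open>pi\<^sup>2 / c\<close> is an
  involution of the positive reals.\<close>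

lemma gaussian_moments_fourier_eq_0_iff:
  fixes u :: "'a::euclidean_space \<Rightarrow> real"
  assumes u: "test_function u"
  shows "(\<forall>c>0. (\<integral>\<xi>. exp (- (c * (norm \<xi>)\<^sup>2)) * ((h \<bullet> \<xi>) * Im (fourier (\<lambda>x. of_real (u x)) \<xi>)) \<partial>lborel) = 0)
    \<longleftrightarrow> (\<forall>c>0. (\<integral>x. exp (- (c * (norm x)\<^sup>2)) * ((h \<bullet> x) * u x) \<partial>lborel) = 0)"
    (is "?L \<longleftrightarrow> ?R")
proof (intro iffI allI impI)
  fix c :: real
  assume ?R "c > 0"
  then have "(\<integral>x. exp (- (pi\<^sup>2 / c * (norm x)\<^sup>2)) * ((h \<bullet> x) * u x) \<partial>lborel) = 0"
    by (simp del: times_divide_eq_left)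
  then show "(\<integral>\<xi>. exp (- (c * (norm \<xi>)\<^sup>2)) * ((h \<bullet> \<xi>) * Im (fourier (\<lambda>x. of_real (u x)) \<xi>)) \<partial>lborel) = 0"
    unfolding gaussian_moment_fourier[OF u \<open>c > 0\<close>] by (simp del: times_divide_eq_left)
next
  fix c :: real
  assume L: ?L and c: "c > 0"
  define d where "d = pi\<^sup>2 / c"
  have d: "d > 0" and cd: "c = pi\<^sup>2 / d" using c by (auto simp: d_def)
  have "sqrt (pi / d) ^ DIM('a) * (pi / d) \<noteq> 0" using d by simp
  then show "(\<integral>x. exp (- (c * (norm x)\<^sup>2)) * ((h \<bullet> x) * u x) \<partial>lborel) = 0"
    using gaussian_moment_fourier[OF u d, of h] L d unfolding cd by (simp del: times_divide_eq_left)
qed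

section \<open>Polar coordinates\<close>

lemma nn_integral_sphere_measure:
  fixes G :: "'a::euclidean_space \<Rightarrow> ennreal"
  assumes [measurable]: "G \<in> borel_measurable borel"
  shows "(\<integral>\<^sup>+\<omega>. G \<omega> \<partial>sphere_measure)
    = of_nat DIM('a) * (\<integral>\<^sup>+x. indicator (ball 0 1 - {0}) x * G (sgn x) \<partial>lborel)"
proof -
  have sgn: "sgn \<in> restrict_space lborel (ball (0::'a) 1 - {0}) \<rightarrow>\<^sub>M restrict_space borel (sphere 0 1)"
    by (rule measurable_restrict_space3) (auto simp: norm_sgn)
  have "G \<in> borel_measurable (restrict_space borel (sphere 0 1))"
    by (rule measurable_restrict_space1) measurable
  then have "(\<integral>\<^sup>+\<omega>. G \<omega> \<partial>sphere_measure)
      = of_nat DIM('a) * (\<integral>\<^sup>+x. G (sgn x) \<partial>restrict_space lborel (ball 0 1 - {0}))"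
    unfolding sphere_measure_def using sgn
    by (subst nn_integral_scale_measure) (simp_all add: nn_integral_distr)
  then show ?thesis
    by (simp add: nn_integral_restrict_space mult.commute)
qed

text \<open>Substituting \<open>r = q|x|\<close>, then \<open>y = qx\<close>, and integrating out \<open>q\<close>.\<close>
lemma nn_integral_polar:
  fixes F :: "'a::euclidean_space \<Rightarrow> ennreal"
  assumes [measurable]: "F \<in> borel_measurable borel"
  shows "(\<integral>\<^sup>+x. F x \<partial>lborel)
    = (\<integral>\<^sup>+r. ennreal (indicator {0<..} r * r ^ (DIM('a) - 1)) * (\<integral>\<^sup>+\<omega>. F (r *\<^sub>R \<omega>) \<partial>sphere_measure) \<partial>lborel)"
proof -
  let ?N = "DIM('a)"
  define B where "B = ball (0::'a) 1 - {0}"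
  define w :: "real \<Rightarrow> real" where "w r = indicator {0<..} r * r ^ (?N - 1)" for r
  \<comment> \<open>What stands in front of \<open>F y\<close> after both substitutions. The unit
    ball in \<open>x\<close> becomes \<open>norm y < q\<close>; with \<open>N\<close> the dimension,
    the Jacobian gives \<open>- N\<close> powers of \<open>q\<close>, the factor
    \<open>norm x ^ N\<close> another \<open>- N\<close>, and the radial weight
    \<open>N - 1\<close>.\<close>
  define k :: "real \<Rightarrow> 'a \<Rightarrow> real"
    where "k q y = indicator {0<..} q * (if y \<noteq> 0 \<and> norm y < q then 1 else 0) * (norm y ^ ?N / q ^ (?N + 1))" for q y
  have [measurable]: "B \<in> sets borel" "w \<in> borel_measurable borel" unfolding B_def w_def by measurable
  have [measurable]: "(\<lambda>(q, y). k q y) \<in> borel_measurable (borel \<Otimes>\<^sub>M borel)"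
    unfolding k_def by measurable
  have w0: "0 \<le> w r" for r by (simp add: w_def indicator_def)
  have k0: "0 \<le> k q y" for q y by (simp add: k_def indicator_def)
  have "(\<integral>\<^sup>+r. w r * (\<integral>\<^sup>+\<omega>. F (r *\<^sub>R \<omega>) \<partial>sphere_measure) \<partial>lborel)
      = (\<integral>\<^sup>+r. of_nat ?N * (\<integral>\<^sup>+x. w r * (indicator B x * F (r *\<^sub>R sgn x)) \<partial>lborel) \<partial>lborel)"
  proof (rule nn_integral_cong)
    fix r
    have "(\<integral>\<^sup>+\<omega>. F (r *\<^sub>R \<omega>) \<partial>sphere_measure) = of_nat ?N * (\<integral>\<^sup>+x. indicator B x * F (r *\<^sub>R sgn x) \<partial>lborel)"
      unfolding B_def by (rule nn_integral_sphere_measure) measurable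
    moreover have "(\<integral>\<^sup>+x. w r * (indicator B x * F (r *\<^sub>R sgn x)) \<partial>lborel) = w r * (\<integral>\<^sup>+x. indicator B x * F (r *\<^sub>R sgn x) \<partial>lborel)"
      by (rule nn_integral_cmult) measurable
    ultimately show "w r * (\<integral>\<^sup>+\<omega>. F (r *\<^sub>R \<omega>) \<partial>sphere_measure)
      = of_nat ?N * (\<integral>\<^sup>+x. w r * (indicator B x * F (r *\<^sub>R sgn x)) \<partial>lborel)"
      by (simp add: mult.left_commute)
  qed
  also have "\<dots> = of_nat ?N * (\<integral>\<^sup>+r. (\<integral>\<^sup>+x. w r * (indicator B x * F (r *\<^sub>R sgn x)) \<partial>lborel) \<partial>lborel)"
    by (rule nn_integral_cmult) measurable
  also have "(\<integral>\<^sup>+r. (\<integral>\<^sup>+x. w r * (indicator B x * F (r *\<^sub>R sgn x)) \<partial>lborel) \<partial>lborel)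
      = (\<integral>\<^sup>+x. (\<integral>\<^sup>+r. w r * (indicator B x * F (r *\<^sub>R sgn x)) \<partial>lborel) \<partial>lborel)"
    by (rule lborel_pair.Fubini') measurable
  also have "\<dots> = (\<integral>\<^sup>+x. (\<integral>\<^sup>+q. ennreal (indicator B x * norm x ^ ?N * w q) * F (q *\<^sub>R x) \<partial>lborel) \<partial>lborel)"
  proof (rule nn_integral_cong)
    fix x :: 'a
    show "(\<integral>\<^sup>+r. w r * (indicator B x * F (r *\<^sub>R sgn x)) \<partial>lborel)
        = (\<integral>\<^sup>+q. ennreal (indicator B x * norm x ^ ?N * w q) * F (q *\<^sub>R x) \<partial>lborel)"
    proof (cases "x \<in> B")
      case True
      then have x: "norm x > 0" by (simp add: B_def)
      have "(\<integral>\<^sup>+r. w r * (indicator B x * F (r *\<^sub>R sgn x)) \<partial>lborel)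
        = ennreal \<bar>norm x\<bar> * (\<integral>\<^sup>+q. w (0 + norm x * q) * (indicator B x * F ((0 + norm x * q) *\<^sub>R sgn x)) \<partial>lborel)"
        using x by (intro nn_integral_real_affine) auto
      also have "\<dots> = (\<integral>\<^sup>+q. ennreal \<bar>norm x\<bar> * (w (0 + norm x * q) * (indicator B x * F ((0 + norm x * q) *\<^sub>R sgn x))) \<partial>lborel)"
        by (rule nn_integral_cmult[symmetric]) measurable
      also have "\<dots> = (\<integral>\<^sup>+q. ennreal (indicator B x * norm x ^ ?N * w q) * F (q *\<^sub>R x) \<partial>lborel)"
      proof (rule nn_integral_cong)
        fix q
        have "(norm x * q) *\<^sub>R sgn x = q *\<^sub>R x" using x by (simp add: sgn_div_norm)
        \<comment> \<open>One power of \<open>norm x\<close> comes from the substitution in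
          \<open>r\<close>, the others from the radial weight.\<close>
        moreover have "norm x * w (norm x * q) = norm x ^ ?N * w q"
          using x power_Suc[of "norm x" "?N - 1"] by (simp add: w_def indicator_def zero_less_mult_iff power_mult_distrib)
        ultimately show "ennreal \<bar>norm x\<bar> * (w (0 + norm x * q) * (indicator B x * F ((0 + norm x * q) *\<^sub>R sgn x)))
          = ennreal (indicator B x * norm x ^ ?N * w q) * F (q *\<^sub>R x)"
          using True w0 by (simp add: mult.assoc[symmetric] ennreal_mult[symmetric])
      qed
      finally show ?thesis .
    qed simp
  qed
  also have "\<dots> = (\<integral>\<^sup>+q. (\<integral>\<^sup>+x. ennreal (indicator B x * norm x ^ ?N * w q) * F (q *\<^sub>R x) \<partial>lborel) \<partial>lborel)"
    by (rule lborel_pair.Fubini') measurable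
  also have "\<dots> = (\<integral>\<^sup>+q. (\<integral>\<^sup>+y. ennreal (k q y) * F y \<partial>lborel) \<partial>lborel)"
  proof (rule nn_integral_cong)
    fix q :: real
    show "(\<integral>\<^sup>+x. ennreal (indicator B x * norm x ^ ?N * w q) * F (q *\<^sub>R x) \<partial>lborel)
        = (\<integral>\<^sup>+y. ennreal (k q y) * F y \<partial>lborel)"
    proof (cases "q > 0")
      case True
      have "(\<integral>\<^sup>+x. ennreal (indicator B x * norm x ^ ?N * w q) * F (q *\<^sub>R x) \<partial>lborel)
        = (\<integral>\<^sup>+x. ennreal (indicator B x * norm x ^ ?N * w q) * F (q *\<^sub>R x)
            \<partial>density (distr lborel borel (\<lambda>x. 0 + (1 / q) *\<^sub>R x)) (\<lambda>_. \<bar>1 / q\<bar> ^ ?N))"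
        using True by (subst lborel_affine[of "1 / q" "0::'a"]) auto
      also have "\<dots> = (\<integral>\<^sup>+y. ennreal (\<bar>1 / q\<bar> ^ ?N) *
          (ennreal (indicator B ((1 / q) *\<^sub>R y) * norm ((1 / q) *\<^sub>R y) ^ ?N * w q) * F (q *\<^sub>R ((1 / q) *\<^sub>R y))) \<partial>lborel)"
        by (simp add: nn_integral_density nn_integral_distr)
      also have "\<dots> = (\<integral>\<^sup>+y. ennreal (k q y) * F y \<partial>lborel)"
      proof (rule nn_integral_cong)
        fix y :: 'a
        have "indicator B ((1 / q) *\<^sub>R y) = (if y \<noteq> 0 \<and> norm y < q then 1 else 0 :: real)"
          using True by (simp add: B_def indicator_def divide_less_eq)
        moreover have "\<bar>1 / q\<bar> ^ ?N * (norm ((1 / q) *\<^sub>R y) ^ ?N * w q) = norm y ^ ?N / q ^ (?N + 1)"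
        proof -
          have "q ^ ?N = q * q ^ (?N - 1)" using power_Suc[of q "?N - 1"] by simp
          then show ?thesis using True by (simp add: w_def field_simps)
        qed
        ultimately have "\<bar>1 / q\<bar> ^ ?N * (indicator B ((1 / q) *\<^sub>R y) * norm ((1 / q) *\<^sub>R y) ^ ?N * w q) = k q y"
          using True by (simp add: k_def)
        then show "ennreal (\<bar>1 / q\<bar> ^ ?N) * (ennreal (indicator B ((1 / q) *\<^sub>R y) * norm ((1 / q) *\<^sub>R y) ^ ?N * w q) * F (q *\<^sub>R ((1 / q) *\<^sub>R y)))
          = ennreal (k q y) * F y"
          using True by (subst mult.assoc[symmetric], subst ennreal_mult[symmetric]) (auto simp: w0)
      qed
      finally show ?thesis .
    qed (simp add: w_def k_def)
  qed
  also have "\<dots> = (\<integral>\<^sup>+y. (\<integral>\<^sup>+q. ennreal (k q y) * F y \<partial>lborel) \<partial>lborel)"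
    by (rule lborel_pair.Fubini') measurable
  also have "of_nat ?N * \<dots> = (\<integral>\<^sup>+y. of_nat ?N * (\<integral>\<^sup>+q. ennreal (k q y) * F y \<partial>lborel) \<partial>lborel)"
    by (rule nn_integral_cmult[symmetric]) measurable
  also have "\<dots> = (\<integral>\<^sup>+y. F y \<partial>lborel)"
  proof (rule nn_integral_cong_AE)
    \<comment> \<open>The kernel vanishes at the origin, where the pointwise identity would force
      \<open>F\<close> to be zero.\<close>
    have "AE y in lborel. y \<noteq> (0::'a)" by (rule AE_lborel_singleton)
    then show "AE y in lborel. of_nat ?N * (\<integral>\<^sup>+q. ennreal (k q y) * F y \<partial>lborel) = F y"
    proof eventually_elim
      fix y :: 'a assume "y \<noteq> 0"
      then have y: "norm y > 0" by simp
      have q0: "0 < q" if "norm y \<le> q" for q using that y by linarith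
      \<comment> \<open>The factor \<open>N\<close> in \<open>sphere_measure\<close> is accounted
        for here: it makes the mass of the kernel in \<open>q\<close> exactly 1.\<close>
      have "(\<integral>\<^sup>+q. ennreal (?N * norm y ^ ?N / q ^ (?N + 1)) * indicator {norm y..} q \<partial>lborel)
          = ennreal (0 - (- (norm y ^ ?N / norm y ^ ?N)))"
      proof (rule nn_integral_FTC_atLeast[where F = "\<lambda>q. - (norm y ^ ?N / q ^ ?N)"])
        show "((\<lambda>q. - (norm y ^ ?N / q ^ ?N)) has_real_derivative ?N * norm y ^ ?N / q ^ (?N + 1)) (at q)"
          if "norm y \<le> q" for q
          proof -
          have "((\<lambda>q. - (norm y ^ ?N / q ^ ?N)) has_real_derivative norm y ^ ?N * (?N * q ^ (?N - 1)) / (q ^ ?N * q ^ ?N)) (at q)"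
            using that y by (auto intro!: derivative_eq_intros)
          moreover have "q ^ ?N = q * q ^ (?N - 1)" using power_Suc[of q "?N - 1"] by simp
          ultimately show ?thesis using that y by (simp add: field_simps)
        qed
        have "((\<lambda>q::real. - (norm y ^ ?N * inverse (q ^ ?N))) \<longlongrightarrow> - (norm y ^ ?N * 0)) at_top"
          by (intro tendsto_intros tendsto_inverse_0_at_top filterlim_pow_at_top filterlim_ident) auto
        then show "((\<lambda>q. - (norm y ^ ?N / q ^ ?N)) \<longlongrightarrow> 0) at_top" by (simp add: divide_inverse)
        show "0 \<le> ?N * norm y ^ ?N / q ^ (?N + 1)" if "norm y \<le> q" for q
          using q0[OF that] by simp
      qed simp
      also have "\<dots> = 1" using y by simp
      finally have 1: "(\<integral>\<^sup>+q. ennreal (?N * norm y ^ ?N / q ^ (?N + 1)) * indicator {norm y..} q \<partial>lborel) = 1" .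
      have "of_nat ?N * (\<integral>\<^sup>+q. ennreal (k q y) * F y \<partial>lborel) = (\<integral>\<^sup>+q. of_nat ?N * ennreal (k q y) \<partial>lborel) * F y"
        by (simp add: nn_integral_multc nn_integral_cmult mult.assoc)
      also have "(\<integral>\<^sup>+q. of_nat ?N * ennreal (k q y) \<partial>lborel)
          = (\<integral>\<^sup>+q. ennreal (?N * norm y ^ ?N / q ^ (?N + 1)) * indicator {norm y..} q \<partial>lborel)"
      proof (rule nn_integral_cong_AE)
        \<comment> \<open>The kernel uses the strict condition \<open>norm y < q\<close>, the
          primitive a closed half-line; they differ at one point.\<close>
        have "AE q in lborel. q \<noteq> norm y" by (rule AE_lborel_singleton)
        then show "AE q in lborel. of_nat ?N * ennreal (k q y)
            = ennreal (?N * norm y ^ ?N / q ^ (?N + 1)) * indicator {norm y..} q"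
        proof eventually_elim
          fix q assume "q \<noteq> norm y"
          then show "of_nat ?N * ennreal (k q y) = ennreal (?N * norm y ^ ?N / q ^ (?N + 1)) * indicator {norm y..} q"
            using q0[of q] \<open>y \<noteq> 0\<close>
            by (cases "norm y < q") (auto simp: k_def indicator_def ennreal_of_nat_eq_real_of_nat ennreal_mult[symmetric])
        qed
      qed
      finally show "of_nat ?N * (\<integral>\<^sup>+q. ennreal (k q y) * F y \<partial>lborel) = F y"
        unfolding 1 by simp
    qed
  qed
  finally show ?thesis by (simp add: w_def)
qed

lemma sets_sphere_measure: "sets (sphere_measure :: 'a::euclidean_space measure) = sets (restrict_space borel (sphere 0 1))"
  and space_sphere_measure: "space (sphere_measure :: 'a::euclidean_space measure) = sphere 0 1"
proof -
  show *: "sets (sphere_measure :: 'a measure) = sets (restrict_space borel (sphere 0 1))"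
    by (simp add: sphere_measure_def)
  show "space (sphere_measure :: 'a measure) = sphere 0 1"
    using sets_eq_imp_space_eq[OF *] by (simp add: space_restrict_space)
qed

lemma measurable_sphere_measure:
  "f \<in> borel_measurable borel \<Longrightarrow> f \<in> borel_measurable (sphere_measure :: 'a::euclidean_space measure)"
  by (simp add: measurable_cong_sets[OF sets_sphere_measure refl] measurable_restrict_space1)

text \<open>The total mass is the dimension times the volume of the punctured unit ball.\<close>

lemma finite_measure_sphere_measure: "finite_measure (sphere_measure :: 'a::euclidean_space measure)"
proof
  have "emeasure (sphere_measure :: 'a measure) (space sphere_measure) = (\<integral>\<^sup>+\<omega>. 1 \<partial>(sphere_measure :: 'a measure))"
    by simp
  also have "\<dots> = of_nat DIM('a) * (\<integral>\<^sup>+x. indicator (ball 0 1 - {0}) (x::'a) \<partial>lborel)"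
    by (subst nn_integral_sphere_measure) auto
  also have "\<dots> \<noteq> \<infinity>"
    using emeasure_bounded_finite[OF bounded_subset[OF bounded_ball Diff_subset], of "0::'a" 1 "{0}"]
    by (auto simp: ennreal_mult_eq_top_iff)
  finally show "emeasure (sphere_measure :: 'a measure) (space sphere_measure) \<noteq> \<infinity>" .
qed

text \<open>An identity of measures rather than of nonnegative integrals, so that signed functions
  can be treated by image measures and Fubini for Bochner integrals.\<close>

lemma lborel_polar:
  "lborel = distr (density lborel (\<lambda>r. ennreal (indicator {0<..} r * r ^ (DIM('a) - 1))) \<Otimes>\<^sub>M sphere_measure) borel
      (\<lambda>(r, \<omega>). r *\<^sub>R \<omega> :: 'a::euclidean_space)" (is "_ = distr (?R \<Otimes>\<^sub>M ?S) borel ?f")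
  and measurable_polar: "(\<lambda>(r, \<omega>). r *\<^sub>R \<omega> :: 'a) \<in> borel \<Otimes>\<^sub>M sphere_measure \<rightarrow>\<^sub>M borel"
proof -
  interpret S: finite_measure "sphere_measure :: 'a measure" by (rule finite_measure_sphere_measure)
  have id: "(\<lambda>\<omega>. \<omega>) \<in> ?S \<rightarrow>\<^sub>M borel" by (rule measurable_sphere_measure) simp
  show f: "?f \<in> borel \<Otimes>\<^sub>M sphere_measure \<rightarrow>\<^sub>M borel"
    unfolding split_beta' by (intro borel_measurable_scaleR measurable_fst measurable_compose[OF measurable_snd id])
  show "lborel = distr (?R \<Otimes>\<^sub>M ?S) borel ?f"
  proof (rule measure_eqI)
    fix A :: "'a set" assume "A \<in> sets lborel"
    then have A [measurable]: "A \<in> sets borel" by simp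
    have fR: "?f \<in> ?R \<Otimes>\<^sub>M ?S \<rightarrow>\<^sub>M borel"
      using f by (simp cong: measurable_cong_sets sets_pair_measure_cong)
    have ind: "(\<lambda>x. indicator A (?f x) :: ennreal) \<in> borel_measurable (?R \<Otimes>\<^sub>M ?S)"
      by (rule measurable_compose[OF fR]) measurable
    have "emeasure (distr (?R \<Otimes>\<^sub>M ?S) borel ?f) A = (\<integral>\<^sup>+x. indicator A x \<partial>distr (?R \<Otimes>\<^sub>M ?S) borel ?f)"
      by simp
    also have "\<dots> = (\<integral>\<^sup>+x. indicator A (?f x) \<partial>(?R \<Otimes>\<^sub>M ?S))"
      by (rule nn_integral_distr[OF fR]) simp
    also have "\<dots> = (\<integral>\<^sup>+r. (\<integral>\<^sup>+\<omega>. indicator A (?f (r, \<omega>)) \<partial>?S) \<partial>?R)"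
      by (rule S.nn_integral_fst[symmetric, OF ind])
    also have "\<dots> = (\<integral>\<^sup>+r. ennreal (indicator {0<..} r * r ^ (DIM('a) - 1)) * (\<integral>\<^sup>+\<omega>. indicator A (r *\<^sub>R \<omega>) \<partial>?S) \<partial>lborel)"
    proof -
      have "(\<lambda>r. \<integral>\<^sup>+\<omega>. indicator A (?f (r, \<omega>)) \<partial>?S) \<in> borel_measurable ?R"
        by (rule S.borel_measurable_nn_integral_fst[OF ind])
      then show ?thesis by (subst nn_integral_density) auto
    qed
    also have "\<dots> = emeasure lborel A"
      by (subst nn_integral_polar[symmetric]) auto
    finally show "emeasure lborel A = emeasure (distr (?R \<Otimes>\<^sub>M ?S) borel ?f) A" ..
  qed simp
qed

text \<open>At radii where the inner function is not integrable its Bochner integral is 0; by Fubini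
  the positive radii of this kind form a null set.\<close>

lemma
  fixes f :: "'a::euclidean_space \<Rightarrow> real"
  assumes f: "integrable lborel f"
  shows integrable_polar: "integrable lborel (\<lambda>r. indicator {0<..} r * r ^ (DIM('a) - 1) * (\<integral>\<omega>. f (r *\<^sub>R \<omega>) \<partial>sphere_measure))"
    and integral_polar: "(\<integral>x. f x \<partial>lborel)
      = (\<integral>r. indicator {0<..} r * r ^ (DIM('a) - 1) * (\<integral>\<omega>. f (r *\<^sub>R \<omega>) \<partial>sphere_measure) \<partial>lborel)"
proof -
  interpret S: finite_measure "sphere_measure :: 'a measure" by (rule finite_measure_sphere_measure)
  define w :: "real \<Rightarrow> real" where "w r = indicator {0<..} r * r ^ (DIM('a) - 1)" for r
  have [measurable]: "w \<in> borel_measurable borel" unfolding w_def by measurable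
  have w0: "0 \<le> w r" for r by (simp add: w_def indicator_def)
  let ?R = "density lborel (\<lambda>r. ennreal (w r))"
  let ?S = "sphere_measure :: 'a measure"
  have polar: "lborel = distr (?R \<Otimes>\<^sub>M ?S) borel (\<lambda>(r, \<omega>). r *\<^sub>R \<omega>)"
    unfolding w_def by (rule lborel_polar)
  have m: "(\<lambda>(r, \<omega>). r *\<^sub>R \<omega> :: 'a) \<in> ?R \<Otimes>\<^sub>M ?S \<rightarrow>\<^sub>M borel"
    using measurable_polar by (simp cong: measurable_cong_sets sets_pair_measure_cong)
  have [measurable]: "f \<in> borel_measurable borel" using f by simp
  interpret R: sigma_finite_measure ?R
    by (rule sigma_finite_measure.sigma_finite_iff_density_finite[THEN iffD2]) (auto intro: sigma_finite_lborel)
  interpret RS: pair_sigma_finite ?R ?S ..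
  have int: "integrable (?R \<Otimes>\<^sub>M ?S) (\<lambda>x. f (case x of (r, \<omega>) \<Rightarrow> r *\<^sub>R \<omega>))"
    using f by (subst (asm) polar, subst (asm) integrable_distr_eq[OF m]) auto
  have fst: "(\<lambda>r. \<integral>\<omega>. f (r *\<^sub>R \<omega>) \<partial>?S) \<in> borel_measurable borel"
    using borel_measurable_integrable[OF RS.integrable_fst'[OF int]] by simp
  have "integrable ?R (\<lambda>r. \<integral>\<omega>. f (r *\<^sub>R \<omega>) \<partial>?S)"
    using RS.integrable_fst'[OF int] by simp
  then show "integrable lborel (\<lambda>r. indicator {0<..} r * r ^ (DIM('a) - 1) * (\<integral>\<omega>. f (r *\<^sub>R \<omega>) \<partial>sphere_measure))"
    using fst w0 by (subst (asm) integrable_density) (auto simp: w_def)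
  have "(\<integral>x. f x \<partial>lborel) = (\<integral>x. f (case x of (r, \<omega>) \<Rightarrow> r *\<^sub>R \<omega>) \<partial>(?R \<Otimes>\<^sub>M ?S))"
    by (subst polar, subst integral_distr[OF m]) auto
  also have "\<dots> = (\<integral>r. (\<integral>\<omega>. f (r *\<^sub>R \<omega>) \<partial>?S) \<partial>?R)"
    using RS.integral_fst'[OF int] by simp
  also have "\<dots> = (\<integral>r. w r * (\<integral>\<omega>. f (r *\<^sub>R \<omega>) \<partial>?S) \<partial>lborel)"
    using fst w0 by (subst integral_density) auto
  finally show "(\<integral>x. f x \<partial>lborel)
      = (\<integral>r. indicator {0<..} r * r ^ (DIM('a) - 1) * (\<integral>\<omega>. f (r *\<^sub>R \<omega>) \<partial>sphere_measure) \<partial>lborel)"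
    by (simp add: w_def)
qed

text \<open>An open null set is empty, which settles \<open>r > 0\<close>. The hypothesis does not
  reach \<open>r = 0\<close>, where the value is a limit along \<open>1 / (n + 1)\<close>.\<close>

lemma continuous_AE_eq_0:
  fixes f :: "real \<Rightarrow> real"
  assumes cont: "continuous_on UNIV f" and ae: "AE r in lborel. 0 < r \<longrightarrow> f r = 0" and "0 \<le> r"
  shows "f r = 0"
proof -
  have pos: "f r = 0" if "0 < r" for r
  proof (rule ccontr)
    assume "f r \<noteq> 0"
    define U where "U = {r. 0 < r \<and> f r \<noteq> 0}"
    have "open U" unfolding U_def
      by (intro open_Collect_conj open_Collect_less open_Collect_neq continuous_intros cont)
    moreover have "U \<in> null_sets lborel"
      by (rule AE_iff_null_sets[THEN iffD2]) (use \<open>open U\<close> ae in \<open>auto simp: U_def\<close>)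
    then have "negligible U"
      by (simp add: negligible_iff_null_sets null_sets_completionI)
    ultimately have "U = {}" using open_not_negligible by blast
    then show False using that \<open>f r \<noteq> 0\<close> by (auto simp: U_def)
  qed
  show ?thesis
  proof (cases "r = 0")
    case True
    have "(\<lambda>n. f (inverse (real (Suc n)))) \<longlonglongrightarrow> f 0"
      using cont LIMSEQ_inverse_real_of_nat by (auto intro: continuous_on_tendsto_compose)
    moreover have "(\<lambda>n. f (inverse (real (Suc n)))) = (\<lambda>_. 0)" by (simp add: pos)
    ultimately show ?thesis using True by (simp add: LIMSEQ_const_iff)
  qed (use pos \<open>0 \<le> r\<close> in auto)
qed

text \<open>In polar coordinates a radial test \<open>G\<close> gives the integral of
  \<open>r ^ N * G r * \<Phi> r\<close>, with \<open>\<Phi>\<close> the spherical moment and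
  \<open>N\<close> the dimension; the exponent is not \<open>N - 1\<close> because
  \<open>h \<bullet> (r *\<^sub>R \<omega>)\<close> contributes one more \<open>r\<close>. Laplace
  uniqueness in the variable \<open>(norm x)\<^sup>2\<close> extends the vanishing from Gaussians to
  \<open>G = \<Phi>\<close>, and then a weighted square integrates to zero.\<close>

lemma spherical_moment_eq_0_iff:
  fixes u :: "'a::euclidean_space \<Rightarrow> real"
  assumes cont: "continuous_on UNIV u" and R: "\<And>x. R < norm x \<Longrightarrow> u x = 0"
  shows "(\<forall>c>0. (\<integral>x. exp (- (c * (norm x)\<^sup>2)) * ((h \<bullet> x) * u x) \<partial>lborel) = 0)
    \<longleftrightarrow> (\<forall>r\<ge>0. (\<integral>\<omega>. (h \<bullet> \<omega>) * u (r *\<^sub>R \<omega>) \<partial>sphere_measure) = 0)"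
proof -
  interpret S: finite_measure "sphere_measure :: 'a measure" by (rule finite_measure_sphere_measure)
  define F where "F x = (h \<bullet> x) * u x" for x
  define \<Phi> where "\<Phi> r = (\<integral>\<omega>. (h \<bullet> \<omega>) * u (r *\<^sub>R \<omega>) \<partial>sphere_measure)" for r
  have contF: "continuous_on UNIV F" unfolding F_def by (intro continuous_intros cont)
  have F0: "R < norm x \<Longrightarrow> F x = 0" for x by (simp add: F_def R)
  have F: "integrable lborel F" by (rule integrable_continuous_bounded_support[OF contF F0])
  have [measurable]: "u \<in> borel_measurable borel" "F \<in> borel_measurable borel"
    using cont contF by (auto intro: borel_measurable_continuous_onI)
  obtain B where B: "B > 0" "\<And>x. norm (u x) \<le> B"
    using bounded_continuous_bounded_support[OF cont, of R] R by metis
  have bound: "\<bar>(h \<bullet> \<omega>) * u (r *\<^sub>R \<omega>)\<bar> \<le> norm h * B" if "norm \<omega> = 1" for \<omega> r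
    using Cauchy_Schwarz_ineq2[of h \<omega>] B(2)[of "r *\<^sub>R \<omega>"] that
    by (auto simp: abs_mult intro!: mult_mono)
  \<comment> \<open>Continuity makes \<open>\<Phi>\<close> an admissible test and later upgrades
    vanishing almost everywhere to vanishing at every radius.\<close>
  have cont\<Phi>: "continuous_on UNIV \<Phi>"
    unfolding continuous_on_sequentially \<Phi>_def comp_def
  proof (intro allI ballI impI, elim conjE)
    fix X :: "nat \<Rightarrow> real" and r assume X: "X \<longlonglongrightarrow> r"
    show "(\<lambda>n. \<integral>\<omega>. (h \<bullet> \<omega>) * u (X n *\<^sub>R \<omega>) \<partial>sphere_measure) \<longlonglongrightarrow> (\<integral>\<omega>. (h \<bullet> \<omega>) * u (r *\<^sub>R \<omega>) \<partial>sphere_measure)"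
    proof (rule integral_dominated_convergence[where w = "\<lambda>_. norm h * B"])
      show "AE \<omega> in sphere_measure. (\<lambda>n. (h \<bullet> \<omega>) * u (X n *\<^sub>R \<omega>)) \<longlonglongrightarrow> (h \<bullet> \<omega>) * u (r *\<^sub>R \<omega>)"
        by (intro AE_I2 tendsto_intros continuous_on_tendsto_compose[OF cont] X) auto
      show "AE \<omega> in sphere_measure. norm ((h \<bullet> \<omega>) * u (X n *\<^sub>R \<omega>)) \<le> norm h * B" for n
        by (rule AE_I2) (use bound in \<open>simp add: space_sphere_measure\<close>)
    qed (auto intro!: measurable_sphere_measure)
  qed
  have polar: "(\<integral>x. G (norm x) * F x \<partial>lborel) = (\<integral>r. indicator {0<..} r * r ^ DIM('a) * G r * \<Phi> r \<partial>lborel)"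
    and polar_int: "integrable lborel (\<lambda>r. indicator {0<..} r * r ^ DIM('a) * G r * \<Phi> r)"
    if G: "integrable lborel (\<lambda>x. G (norm x) * F x)" for G :: "real \<Rightarrow> real"
  proof -
    have eq: "indicator {0<..} r * r ^ (DIM('a) - 1) * (\<integral>\<omega>. G (norm (r *\<^sub>R \<omega>)) * F (r *\<^sub>R \<omega>) \<partial>(sphere_measure :: 'a measure))
        = indicator {0<..} r * r ^ DIM('a) * G r * \<Phi> r" for r
    proof (cases "0 < r")
      case True
      have "(\<integral>\<omega>. G (norm (r *\<^sub>R \<omega>)) * F (r *\<^sub>R \<omega>) \<partial>(sphere_measure :: 'a measure))
          = (\<integral>\<omega>. (G r * r) * ((h \<bullet> \<omega>) * u (r *\<^sub>R \<omega>)) \<partial>sphere_measure)"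
        using True by (intro Bochner_Integration.integral_cong) (auto simp: space_sphere_measure F_def)
      also have "\<dots> = G r * r * \<Phi> r" unfolding \<Phi>_def by (rule integral_mult_right_zero)
      finally show ?thesis using power_Suc[of r "DIM('a) - 1"] by simp
    qed simp
    show "(\<integral>x. G (norm x) * F x \<partial>lborel) = (\<integral>r. indicator {0<..} r * r ^ DIM('a) * G r * \<Phi> r \<partial>lborel)"
      and "integrable lborel (\<lambda>r. indicator {0<..} r * r ^ DIM('a) * G r * \<Phi> r)"
      using integral_polar[OF G] integrable_polar[OF G] by (simp_all only: eq)
  qed
  show ?thesis unfolding F_def[symmetric] \<Phi>_def[symmetric]
  proof (intro iffI allI impI)
    fix c :: real assume "\<forall>r\<ge>0. \<Phi> r = 0" "c > 0"
    have "integrable lborel (\<lambda>x. exp (- (c * (norm x)\<^sup>2)) * F x)"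
      by (rule integrable_continuous_bounded_support[where R = R]) (auto intro!: continuous_intros contF simp: F0)
    note polar[of "\<lambda>r. exp (- (c * r\<^sup>2))", OF this]
    moreover have "indicator {0<..} r * r ^ DIM('a) * exp (- (c * r\<^sup>2)) * \<Phi> r = 0" for r
      using \<open>\<forall>r\<ge>0. \<Phi> r = 0\<close> by (simp add: indicator_def)
    ultimately show "(\<integral>x. exp (- (c * (norm x)\<^sup>2)) * F x \<partial>lborel) = 0"
      by (simp only: Bochner_Integration.integral_zero)
  next
    fix r :: real
    assume L: "\<forall>c>0. (\<integral>x. exp (- (c * (norm x)\<^sup>2)) * F x \<partial>lborel) = 0" and r: "0 \<le> r"
    have int: "integrable lborel (\<lambda>x. \<Phi> (norm x) * F x)"
      by (rule integrable_continuous_bounded_support[where R = R])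
         (auto intro!: continuous_intros contF continuous_on_compose2[OF cont\<Phi>] simp: F0)
    have [measurable]: "\<Phi> \<in> borel_measurable borel" by (rule borel_measurable_continuous_onI[OF cont\<Phi>])
    \<comment> \<open>The moment is tested against itself; the root undoes the square in the Laplace
      variable.\<close>
    have "(\<integral>x. \<Phi> (sqrt ((norm x)\<^sup>2)) * F x \<partial>lborel) = 0"
      by (rule integral_eq_0_of_laplace_eq_0[OF F, where f = "\<lambda>z. \<Phi> (sqrt z)"]) (use L int in auto)
    then have "(\<integral>r. indicator {0<..} r * r ^ DIM('a) * \<Phi> r * \<Phi> r \<partial>lborel) = 0"
      using polar[OF int] by simp
    then have "AE r in lborel. indicator {0<..} r * r ^ DIM('a) * \<Phi> r * \<Phi> r = 0"
      by (subst (asm) integral_nonneg_eq_0_iff_AE[OF polar_int[OF int]])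
         (auto intro!: AE_I2 simp: indicator_def mult.assoc)
    then have "AE r in lborel. 0 < r \<longrightarrow> \<Phi> r = 0" by eventually_elim auto
    then show "\<Phi> r = 0" using continuous_AE_eq_0[OF cont\<Phi> _ r] by blast
  qed
qed

section \<open>The wave multiplier\<close>

text \<open>Reflection preserves Lebesgue measure, so the integral equals its own negative.\<close>

lemma lborel_integral_odd:
  fixes f :: "'a::euclidean_space \<Rightarrow> real"
  assumes [measurable]: "f \<in> borel_measurable borel" and odd: "\<And>x. f (- x) = - f x"
  shows "(\<integral>x. f x \<partial>lborel) = 0"
proof -
  have "(lborel :: 'a measure) = distr lborel borel uminus"
    using lborel_affine[of "- 1" "0::'a"] by (simp add: density_1)
  then have "(\<integral>x. f x \<partial>lborel) = (\<integral>x. f x \<partial>distr lborel borel uminus)" by simp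
  also have "\<dots> = (\<integral>x. f (- x) \<partial>lborel)" by (rule integral_distr) auto
  also have "\<dots> = - (\<integral>x. f x \<partial>lborel)" by (simp add: odd)
  finally show ?thesis by simp
qed

text \<open>The source of the oddness of the imaginary part of the transform.\<close>

lemma fourier_real_uminus:
  "fourier (\<lambda>x. of_real (u x)) (- \<xi>) = cnj (fourier (\<lambda>x. of_real (u x)) \<xi>)"
proof -
  have "of_real (u x) * exp (- 2 * pi * \<i> * of_real (x \<bullet> - \<xi>))
      = cnj (of_real (u x) * exp (- 2 * pi * \<i> * of_real (x \<bullet> \<xi>)))" for x
    by (simp add: exp_cnj)
  then show ?thesis unfolding fourier_def by (simp only: Bochner_Integration.integral_cnj)
qed

text \<open>The symbol in \<open>frac_wave_solution\<close>. Its value at \<open>\<xi> = 0\<close>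
  is the default 0 of a quotient by zero, which is compatible with the bound by
  \<open>t\<close>.\<close>

definition wave_multiplier :: "real \<Rightarrow> real \<Rightarrow> 'a::real_normed_vector \<Rightarrow> real" where
  "wave_multiplier s t \<xi> = sin (t * (2 * pi * norm \<xi>) powr s) / (2 * pi * norm \<xi>) powr s"

lemma abs_wave_multiplier_le: "0 \<le> t \<Longrightarrow> \<bar>wave_multiplier s t \<xi>\<bar> \<le> t"
  unfolding wave_multiplier_def
  using abs_sin_x_le_abs_x[of "t * (2 * pi * norm \<xi>) powr s"] by (auto simp: divide_le_eq abs_mult)

lemma wave_multiplier_measurable [measurable]:
  "wave_multiplier s t \<in> borel_measurable (borel :: 'a::euclidean_space measure)"
  unfolding wave_multiplier_def[abs_def] by measurable

text \<open>Both families of tests are functions of the norm. The multiplier is bounded by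
  \<open>t\<close>, hence admissible in Laplace uniqueness for the variable
  \<open>(norm \<xi>)\<^sup>2\<close>. For the other direction its denominator is moved into the
  weight, which leaves a pure sine in \<open>t\<close>.\<close>

lemma wave_multiplier_moments_eq_0_iff:
  fixes g :: "'a::euclidean_space \<Rightarrow> real"
  assumes s: "0 < s" "s < 1"
    and g: "integrable lborel g" and hg: "integrable lborel (\<lambda>\<xi>. (h \<bullet> \<xi>) * g \<xi>)"
    and odd: "\<And>\<xi>. g (- \<xi>) = - g \<xi>"
  shows "(\<forall>t>0. (\<integral>\<xi>. wave_multiplier s t \<xi> * ((h \<bullet> \<xi>) * g \<xi>) \<partial>lborel) = 0)
    \<longleftrightarrow> (\<forall>c>0. (\<integral>\<xi>. exp (- (c * (norm \<xi>)\<^sup>2)) * ((h \<bullet> \<xi>) * g \<xi>) \<partial>lborel) = 0)"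
proof (intro iffI allI impI)
  fix t :: real
  assume L: "\<forall>c>0. (\<integral>\<xi>. exp (- (c * (norm \<xi>)\<^sup>2)) * ((h \<bullet> \<xi>) * g \<xi>) \<partial>lborel) = 0" and t: "0 < t"
  have [measurable]: "g \<in> borel_measurable borel" using g by simp
  define f where "f z = sin (t * (2 * pi * sqrt z) powr s) / (2 * pi * sqrt z) powr s" for z
  have [measurable]: "f \<in> borel_measurable borel" unfolding f_def[abs_def] by measurable
  have f: "f ((norm \<xi>)\<^sup>2) = wave_multiplier s t \<xi>" for \<xi> :: 'a by (simp add: f_def wave_multiplier_def)
  have "(\<integral>\<xi>. f ((norm \<xi>)\<^sup>2) * ((h \<bullet> \<xi>) * g \<xi>) \<partial>lborel) = 0"
  proof (rule integral_eq_0_of_laplace_eq_0[OF hg, where f = f])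
    have "integrable lborel (\<lambda>\<xi>. t * ((h \<bullet> \<xi>) * g \<xi>))" using hg by simp
    then show "integrable lborel (\<lambda>\<xi>. f ((norm \<xi>)\<^sup>2) * ((h \<bullet> \<xi>) * g \<xi>))"
      unfolding f
      by (rule Bochner_Integration.integrable_bound)
         (use abs_wave_multiplier_le[of t s] t in \<open>auto intro!: AE_I2 mult_right_mono simp: abs_mult\<close>)
  qed (use L in auto)
  then show "(\<integral>\<xi>. wave_multiplier s t \<xi> * ((h \<bullet> \<xi>) * g \<xi>) \<partial>lborel) = 0" by (simp add: f)
next
  fix c :: real
  assume W: "\<forall>t>0. (\<integral>\<xi>. wave_multiplier s t \<xi> * ((h \<bullet> \<xi>) * g \<xi>) \<partial>lborel) = 0" and c: "0 < c"
  have [measurable]: "g \<in> borel_measurable borel" using g by simp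
  define a where "a \<xi> = (2 * pi * norm \<xi>) powr s" for \<xi> :: 'a
  have [measurable]: "a \<in> borel_measurable borel" unfolding a_def[abs_def] by measurable
  have a: "0 \<le> a \<xi>" "a (- \<xi>) = a \<xi>" for \<xi> by (auto simp: a_def)
  \<comment> \<open>Giving \<open>a\<close> the sign of \<open>h \<bullet> \<xi>\<close> turns the sine transform into a full Fourier transform:
    the cosine part vanishes since \<open>g\<close> is odd.\<close>
  define \<phi> where "\<phi> \<xi> = sgn (h \<bullet> \<xi>) * a \<xi>" for \<xi>
  define g' where "g' \<xi> = \<bar>h \<bullet> \<xi>\<bar> * g \<xi> / a \<xi>" for \<xi>
  \<comment> \<open>The leading \<open>z\<close> cancels the division by \<open>a\<close> and
    restores the sign of \<open>h \<bullet> \<xi>\<close>; the power \<open>1 / s\<close> recovers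
    \<open>norm \<xi>\<close> from \<open>a\<close>.\<close>
  define f where "f z = z * exp (- (c * (\<bar>z\<bar> powr (1 / s) / (2 * pi))\<^sup>2))" for z
  have m [measurable]: "\<phi> \<in> borel_measurable borel" "g' \<in> borel_measurable borel" "f \<in> borel_measurable borel"
    unfolding \<phi>_def[abs_def] g'_def[abs_def] f_def[abs_def] sgn_real_def by measurable
  \<comment> \<open>Away from the origin \<open>a\<close> is at least 1. Near it
    \<open>s < 1\<close> gives \<open>a \<xi> \<ge> norm \<xi>\<close>, and Cauchy-Schwarz bounds
    the quotient by \<open>norm h\<close>. The two summands match the two integrability
    hypotheses.\<close>
  have quot: "\<bar>h \<bullet> \<xi>\<bar> / a \<xi> \<le> \<bar>h \<bullet> \<xi>\<bar> + norm h" for \<xi>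
  proof (cases "2 * pi * norm \<xi> \<ge> 1")
    case True
    then have "1 \<le> a \<xi>" using s by (simp add: a_def ge_one_powr_ge_zero)
    then have "\<bar>h \<bullet> \<xi>\<bar> / a \<xi> \<le> \<bar>h \<bullet> \<xi>\<bar>" by (simp add: divide_le_eq mult_le_cancel_left1)
    then show ?thesis by (simp add: add_increasing2)
  next
    case False
    show ?thesis
    proof (cases "\<xi> = 0")
      case False
      have "norm \<xi> \<le> 2 * pi * norm \<xi>" using pi_gt3 by (simp add: mult_le_cancel_right1)
      also have "\<dots> = (2 * pi * norm \<xi>) powr 1" by simp
      also have "\<dots> \<le> a \<xi>"
        unfolding a_def using \<open>\<not> 1 \<le> 2 * pi * norm \<xi>\<close> s by (intro powr_mono') auto
      finally have "norm \<xi> \<le> a \<xi>" .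
      moreover have "0 < a \<xi>" using False by (simp add: a_def)
      ultimately have "\<bar>h \<bullet> \<xi>\<bar> / a \<xi> \<le> norm h"
        using Cauchy_Schwarz_ineq2[of h \<xi>] by (simp add: divide_le_eq) (meson mult_left_mono norm_ge_zero order_trans)
      then show ?thesis by simp
    qed simp
  qed
  have g': "integrable lborel g'"
  proof (rule Bochner_Integration.integrable_bound)
    show "integrable lborel (\<lambda>\<xi>. \<bar>(h \<bullet> \<xi>) * g \<xi>\<bar> + norm h * \<bar>g \<xi>\<bar>)"
      using g hg by (intro Bochner_Integration.integrable_add integrable_mult_right integrable_abs)
    have "\<bar>g' \<xi>\<bar> \<le> \<bar>(h \<bullet> \<xi>) * g \<xi>\<bar> + norm h * \<bar>g \<xi>\<bar>" for \<xi>
      using mult_right_mono[OF quot[of \<xi>] abs_ge_zero[of "g \<xi>"]] a(1)[of \<xi>]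
      by (simp add: g'_def abs_mult distrib_right)
    then show "AE \<xi> in lborel. norm (g' \<xi>) \<le> norm (\<bar>(h \<bullet> \<xi>) * g \<xi>\<bar> + norm h * \<bar>g \<xi>\<bar>)" by simp
  qed simp
  have f: "f (\<phi> \<xi>) * g' \<xi> = exp (- (c * (norm \<xi>)\<^sup>2)) * ((h \<bullet> \<xi>) * g \<xi>)" for \<xi>
  proof (cases "h \<bullet> \<xi> = 0")
    case False
    then have "a \<xi> > 0" by (auto simp: a_def)
    moreover have "\<bar>\<phi> \<xi>\<bar> powr (1 / s) = 2 * pi * norm \<xi>"
      using False s by (simp add: \<phi>_def abs_mult a_def powr_powr abs_sgn_eq)
    ultimately show ?thesis
      using mult_sgn_abs[of "h \<bullet> \<xi>"] by (simp add: f_def \<phi>_def g'_def)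
  qed (simp add: f_def \<phi>_def)
  have "(\<integral>\<xi>. f (\<phi> \<xi>) * g' \<xi> \<partial>lborel) = 0"
  proof (rule integral_eq_0_of_char_eq_0[OF g', where \<phi> = \<phi> and f = f])
    show "(\<integral>\<xi>. cos (t * \<phi> \<xi>) * g' \<xi> \<partial>lborel) = 0" for t
      by (rule lborel_integral_odd) (auto simp: \<phi>_def g'_def odd a)
    \<comment> \<open>The sine is odd, so the sign in \<open>\<phi>\<close> comes out and turns
      \<open>\<bar>h \<bullet> \<xi>\<bar>\<close> back into
      \<open>h \<bullet> \<xi>\<close>.\<close>
    have sin: "sin (t * \<phi> \<xi>) * g' \<xi> = wave_multiplier s t \<xi> * ((h \<bullet> \<xi>) * g \<xi>)" for t \<xi>
      by (cases "h \<bullet> \<xi>" "0::real" rule: linorder_cases)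
         (auto simp: \<phi>_def g'_def a_def wave_multiplier_def)
    \<comment> \<open>A characteristic function needs every real \<open>t\<close>; oddness in
      \<open>t\<close> supplies the negative ones.\<close>
    have "wave_multiplier s (- t) \<xi> = - wave_multiplier s t \<xi>" for t and \<xi> :: 'a
      by (simp add: wave_multiplier_def)
    then show "(\<integral>\<xi>. sin (t * \<phi> \<xi>) * g' \<xi> \<partial>lborel) = 0" for t
      unfolding sin using W[rule_format, of t] W[rule_format, of "- t"]
      by (cases t "0::real" rule: linorder_cases) (auto simp: wave_multiplier_def[of _ 0])
    show "integrable lborel (\<lambda>\<xi>. f (\<phi> \<xi>) * g' \<xi>)"
      unfolding f using c by (intro Bochner_Integration.integrable_bound[OF hg])
        (auto intro!: AE_I2 mult_left_le_one_le simp: abs_mult)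
  qed auto
  then show "(\<integral>\<xi>. exp (- (c * (norm \<xi>)\<^sup>2)) * ((h \<bullet> \<xi>) * g \<xi>) \<partial>lborel) = 0" by (simp add: f)
qed

section \<open>The spatial gradient at the origin\<close>

text \<open>Differentiability of \<open>v\<close> is given, so only the value \<open>D h\<close> has
  to be found, along the increments \<open>1 / (n + 1)\<close>. The quotients of the exponential are
  at most \<open>2 * pi * \<bar>h \<bullet> \<xi>\<bar>\<close>, which is integrable against
  \<open>g\<close>. As \<open>D h\<close> is real, the real part of \<open>2 * pi * \<i>\<close>
  times the limit integral selects the imaginary part of \<open>g\<close>.\<close>

lemma directional_derivative_inverse_fourier:
  fixes g :: "'a::euclidean_space \<Rightarrow> complex" and v :: "'a \<Rightarrow> real"
  assumes g: "integrable lborel g" and hg: "integrable lborel (\<lambda>\<xi>. of_real (h \<bullet> \<xi>) * g \<xi>)"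
    and v: "\<And>x. of_real (v x) = inverse_fourier g x" and der: "(v has_derivative D) (at 0)"
  shows "D h = - 2 * pi * (\<integral>\<xi>. (h \<bullet> \<xi>) * Im (g \<xi>) \<partial>lborel)"
proof -
  have [measurable]: "g \<in> borel_measurable borel" using g by simp
  define b :: complex where "b = 2 * pi * \<i>"
  define E where "E \<xi> x = exp (b * of_real (x \<bullet> \<xi>))" for x \<xi> :: 'a
  have normE: "norm (E \<xi> x) = 1" for x \<xi> by (simp add: E_def b_def norm_exp_eq_Re)
  have E: "(E \<xi> has_derivative (\<lambda>k. b * of_real (k \<bullet> \<xi>) * E \<xi> x)) (at x)" for x \<xi>
  proof -
    have "((\<lambda>x. b * of_real (x \<bullet> \<xi>)) has_derivative (\<lambda>k. b * of_real (k \<bullet> \<xi>))) (at x)"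
      by (intro has_derivative_mult_right has_derivative_of_real has_derivative_inner_left has_derivative_ident)
    from has_derivative_compose[OF this DERIV_exp[unfolded has_field_derivative_def]]
    show ?thesis unfolding E_def by (simp add: mult.commute)
  qed
  have [measurable]: "(\<lambda>\<xi>. E \<xi> x) \<in> borel_measurable borel" for x unfolding E_def by measurable
  define q where "q n \<xi> = real (Suc n) *\<^sub>R (E \<xi> (0 + inverse (real (Suc n)) *\<^sub>R h) - E \<xi> 0)" for n \<xi>
  have [measurable]: "q n \<in> borel_measurable borel" for n unfolding q_def[abs_def] by measurable
  have gE: "integrable lborel (\<lambda>\<xi>. g \<xi> * E \<xi> x)" for x
    by (rule Bochner_Integration.integrable_bound[OF g]) (auto simp: norm_mult normE)
  have vE: "of_real (v x) = (\<integral>\<xi>. g \<xi> * E \<xi> x \<partial>lborel)" for x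
    by (simp add: v inverse_fourier_def E_def b_def)
  have bound: "norm (q n \<xi>) \<le> 2 * pi * \<bar>h \<bullet> \<xi>\<bar>" for n \<xi>
  proof -
    have "norm (q n \<xi>) = real (Suc n) * norm (E \<xi> (0 + inverse (real (Suc n)) *\<^sub>R h) - E \<xi> 0)"
      unfolding q_def by simp
    also have "\<dots> \<le> real (Suc n) * ((2 * pi * \<bar>h \<bullet> \<xi>\<bar>) * \<bar>inverse (real (Suc n))\<bar>)"
      by (intro mult_left_mono norm_directional_increment_le[OF E]) (auto simp: norm_mult normE b_def)
    also have "\<dots> = 2 * pi * \<bar>h \<bullet> \<xi>\<bar>" by (simp add: field_simps)
    finally show ?thesis .
  qed
  have "(\<lambda>n. \<integral>\<xi>. g \<xi> * q n \<xi> \<partial>lborel) \<longlonglongrightarrow> (\<integral>\<xi>. g \<xi> * (b * of_real (h \<bullet> \<xi>)) \<partial>lborel)"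
  proof (rule integral_dominated_convergence)
    show "integrable lborel (\<lambda>\<xi>. 2 * pi * norm (of_real (h \<bullet> \<xi>) * g \<xi>))"
      using hg by (intro integrable_mult_right integrable_norm)
    show "AE \<xi> in lborel. norm (g \<xi> * q n \<xi>) \<le> 2 * pi * norm (of_real (h \<bullet> \<xi>) * g \<xi>)" for n
      
    proof (rule AE_I2)
      fix \<xi>
      show "norm (g \<xi> * q n \<xi>) \<le> 2 * pi * norm (of_real (h \<bullet> \<xi>) * g \<xi>)"
        using mult_left_mono[OF bound[of n \<xi>] norm_ge_zero[of "g \<xi>"]] by (simp add: norm_mult mult_ac)
    qed
    have "(\<lambda>n. q n \<xi>) \<longlonglongrightarrow> b * of_real (h \<bullet> \<xi>) * E \<xi> 0" for \<xi>
      unfolding q_def by (rule directional_difference_quotient[OF E])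
    then show "AE \<xi> in lborel. (\<lambda>n. g \<xi> * q n \<xi>) \<longlonglongrightarrow> g \<xi> * (b * of_real (h \<bullet> \<xi>))"
      by (intro AE_I2 tendsto_mult_left) (simp add: E_def)
  qed auto
  moreover have "(\<integral>\<xi>. g \<xi> * q n \<xi> \<partial>lborel)
      = of_real (real (Suc n) *\<^sub>R (v (0 + inverse (real (Suc n)) *\<^sub>R h) - v 0))" for n
  proof -
    have "(\<integral>\<xi>. g \<xi> * q n \<xi> \<partial>lborel) = (\<integral>\<xi>. of_nat (Suc n) * (g \<xi> * E \<xi> (0 + inverse (real (Suc n)) *\<^sub>R h) - g \<xi> * E \<xi> 0) \<partial>lborel)"
      by (simp add: q_def scaleR_conv_of_real algebra_simps)
    also have "\<dots> = of_nat (Suc n) * (of_real (v (0 + inverse (real (Suc n)) *\<^sub>R h)) - of_real (v 0))"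
      unfolding vE using gE by (simp only: integral_mult_right_zero Bochner_Integration.integral_diff)
    finally show ?thesis by simp
  qed
  ultimately have "(\<lambda>n. complex_of_real (real (Suc n) *\<^sub>R (v (0 + inverse (real (Suc n)) *\<^sub>R h) - v 0)))
      \<longlonglongrightarrow> (\<integral>\<xi>. g \<xi> * (b * of_real (h \<bullet> \<xi>)) \<partial>lborel)" by simp
  moreover have "(\<lambda>n. complex_of_real (real (Suc n) *\<^sub>R (v (0 + inverse (real (Suc n)) *\<^sub>R h) - v 0))) \<longlonglongrightarrow> of_real (D h)"
    by (intro tendsto_of_real directional_difference_quotient der)
  ultimately have "complex_of_real (D h) = (\<integral>\<xi>. g \<xi> * (b * of_real (h \<bullet> \<xi>)) \<partial>lborel)"
    by (rule LIMSEQ_unique[rotated])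
  also have "\<dots> = b * (\<integral>\<xi>. of_real (h \<bullet> \<xi>) * g \<xi> \<partial>lborel)"
    by (subst integral_mult_right_zero[symmetric]) (simp add: mult_ac)
  finally have "D h = Re (b * (\<integral>\<xi>. of_real (h \<bullet> \<xi>) * g \<xi> \<partial>lborel))"
    by (metis Re_complex_of_real)
  also have "\<dots> = - 2 * pi * (\<integral>\<xi>. Im (of_real (h \<bullet> \<xi>) * g \<xi>) \<partial>lborel)"
    using integral_Im[OF hg] by (simp add: b_def)
  finally show ?thesis by simp
qed

theorem theorem3p7:
  fixes s L :: real
    and u\<^sub>0 :: "real ^ 'n \<Rightarrow> real"
    and w :: "real ^ 'n \<Rightarrow> real \<Rightarrow> real"
  assumes "0 < s" and "s < 1"
    and "test_function u\<^sub>0"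
    and "L > 0" and "supp u\<^sub>0 \<subseteq> ball 0 L"
    and "frac_wave_solution s u\<^sub>0 w"
  shows "(\<forall>t>0. GDERIV (\<lambda>x. w x t) 0 :> 0) \<longleftrightarrow>
         (\<forall>r\<ge>0. (\<integral>\<omega>. u\<^sub>0 (r *\<^sub>R \<omega>) *\<^sub>R \<omega> \<partial>sphere_measure) = 0)"
proof -
  note u = \<open>test_function u\<^sub>0\<close>
  define U where "U = fourier (\<lambda>y. of_real (u\<^sub>0 y))"
  have U: "integrable lborel U" "integrable lborel (\<lambda>\<xi>. of_real (h \<bullet> \<xi>) * U \<xi>)" for h
    unfolding U_def by (rule fourier_test_function_integrable[OF u] fourier_test_function_integrable_inner[OF u])+
  have ImU: "integrable lborel (\<lambda>\<xi>. Im (U \<xi>))" "integrable lborel (\<lambda>\<xi>. (h \<bullet> \<xi>) * Im (U \<xi>))" for h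
    using integrable_Im[OF U(1)] integrable_Im[OF U(2)[of h]] by simp_all
  have oddU: "Im (U (- \<xi>)) = - Im (U \<xi>)" for \<xi>
    by (simp add: U_def fourier_real_uminus)
  have gderiv: "GDERIV (\<lambda>x. w x t) 0 :> 0 \<longleftrightarrow>
      (\<forall>h. (\<integral>\<xi>. wave_multiplier s t \<xi> * ((h \<bullet> \<xi>) * Im (U \<xi>)) \<partial>lborel) = 0)" if t: "t > 0" for t
  proof -
    \<comment> \<open>The gradient exists because \<open>w\<close> is jointly smooth for
      \<open>t > 0\<close>; the Fourier formula then evaluates it.\<close>
    have "Ck_on (Suc 0) (UNIV \<times> {0<..}) (\<lambda>(x, t). w x t)"
      using \<open>frac_wave_solution s u\<^sub>0 w\<close>
      by (simp only: frac_wave_solution_def solves_frac_wave_def smooth_on_def)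
    with t obtain D' where "((\<lambda>(x, t). w x t) has_derivative D') (at (0, t))" by auto
    moreover have "((\<lambda>x. (x, t)) has_derivative (\<lambda>x. (x, 0))) (at 0)"
      by (auto intro!: derivative_eq_intros)
    ultimately have D: "((\<lambda>x. w x t) has_derivative (\<lambda>h. D' (h, 0))) (at 0)"
      using has_derivative_compose[of "\<lambda>x. (x, t)"] by fastforce
    have bdd: "norm (complex_of_real (wave_multiplier s t \<xi>) * z) \<le> norm (of_real t * z)" for \<xi> :: "real ^ 'n" and z
      using abs_wave_multiplier_le[of t s \<xi>] t by (simp add: norm_mult mult_right_mono)
    have [measurable]: "U \<in> borel_measurable borel" using U(1) by simp
    have Dh: "D' (h, 0) = - 2 * pi * (\<integral>\<xi>. wave_multiplier s t \<xi> * ((h \<bullet> \<xi>) * Im (U \<xi>)) \<partial>lborel)" for h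
    proof -
      have "D' (h, 0) = - 2 * pi * (\<integral>\<xi>. (h \<bullet> \<xi>) * Im (of_real (wave_multiplier s t \<xi>) * U \<xi>) \<partial>lborel)"
      proof (rule directional_derivative_inverse_fourier[OF _ _ _ D])
        show "integrable lborel (\<lambda>\<xi>. of_real (wave_multiplier s t \<xi>) * U \<xi>)"
          by (rule Bochner_Integration.integrable_bound[OF integrable_mult_right[OF U(1), of "of_real t"]])
             (auto intro!: AE_I2 bdd)
        have "integrable lborel (\<lambda>\<xi>. of_real (wave_multiplier s t \<xi>) * (of_real (h \<bullet> \<xi>) * U \<xi>))"
          by (rule Bochner_Integration.integrable_bound[OF integrable_mult_right[OF U(2)[of h], of "of_real t"]])
             (auto intro!: AE_I2 bdd)
        then show "integrable lborel (\<lambda>\<xi>. of_real (h \<bullet> \<xi>) * (of_real (wave_multiplier s t \<xi>) * U \<xi>))"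
          by (simp add: mult_ac)
        show "of_real (w x t) = inverse_fourier (\<lambda>\<xi>. of_real (wave_multiplier s t \<xi>) * U \<xi>) x" for x
          using \<open>frac_wave_solution s u\<^sub>0 w\<close> t
          by (simp add: frac_wave_solution_def wave_multiplier_def U_def)
      qed
      then show ?thesis by (simp add: mult_ac)
    qed
    have "GDERIV (\<lambda>x. w x t) 0 :> 0 \<longleftrightarrow> (\<forall>h. D' (h, 0) = 0)"
    proof
      assume "GDERIV (\<lambda>x. w x t) 0 :> 0"
      then have "((\<lambda>x. w x t) has_derivative (\<lambda>_. 0)) (at 0)" by (simp add: gderiv_def)
      from has_derivative_unique[OF D this] show "\<forall>h. D' (h, 0) = 0" by metis
    next
      assume "\<forall>h. D' (h, 0) = 0"
      then show "GDERIV (\<lambda>x. w x t) 0 :> 0" using D by (simp add: gderiv_def)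
    qed
    then show ?thesis by (simp add: Dh)
  qed
  \<comment> \<open>The vector-valued condition is tested against each fixed \<open>h\<close>;
    boundedness of \<open>u\<^sub>0\<close> on a finite measure space lets the inner product pass
    under the integral.\<close>
  have sphere: "(\<integral>\<omega>. u\<^sub>0 (r *\<^sub>R \<omega>) *\<^sub>R \<omega> \<partial>sphere_measure) = 0
      \<longleftrightarrow> (\<forall>h. (\<integral>\<omega>. (h \<bullet> \<omega>) * u\<^sub>0 (r *\<^sub>R \<omega>) \<partial>sphere_measure) = 0)" for r
  proof -
    interpret S: finite_measure "sphere_measure :: (real ^ 'n) measure" by (rule finite_measure_sphere_measure)
    obtain B where B: "\<And>x. norm (u\<^sub>0 x) \<le> B"
      using bounded_continuous_bounded_support[OF test_function_continuous[OF u]] test_function_boundE[OF u] by metis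
    have [measurable]: "u\<^sub>0 \<in> borel_measurable borel" using u by (rule test_function_measurable)
    have int: "integrable sphere_measure (\<lambda>\<omega>. u\<^sub>0 (r *\<^sub>R \<omega>) *\<^sub>R \<omega>)"
      by (rule S.integrable_const_bound[where B = B])
         (auto intro!: AE_I2 measurable_sphere_measure B[unfolded real_norm_def] simp: space_sphere_measure)
    have "h \<bullet> (\<integral>\<omega>. u\<^sub>0 (r *\<^sub>R \<omega>) *\<^sub>R \<omega> \<partial>sphere_measure) = (\<integral>\<omega>. (h \<bullet> \<omega>) * u\<^sub>0 (r *\<^sub>R \<omega>) \<partial>sphere_measure)" for h
      using int by (subst integral_inner_right[symmetric]) (auto simp: mult.commute)
    moreover have "V = 0 \<longleftrightarrow> (\<forall>h. h \<bullet> V = 0)" for V :: "real ^ 'n"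
      by (metis inner_eq_zero_iff inner_zero_right)
    ultimately show ?thesis by simp
  qed
  obtain R where R: "\<And>x. R < norm x \<Longrightarrow> u\<^sub>0 x = 0" using test_function_boundE[OF u] by metis
  have "(\<forall>t>0. GDERIV (\<lambda>x. w x t) 0 :> 0)
      \<longleftrightarrow> (\<forall>h. \<forall>t>0. (\<integral>\<xi>. wave_multiplier s t \<xi> * ((h \<bullet> \<xi>) * Im (U \<xi>)) \<partial>lborel) = 0)"
    using gderiv by blast
  also have "\<dots> \<longleftrightarrow> (\<forall>h. \<forall>c>0. (\<integral>\<xi>. exp (- (c * (norm \<xi>)\<^sup>2)) * ((h \<bullet> \<xi>) * Im (U \<xi>)) \<partial>lborel) = 0)"
    using wave_multiplier_moments_eq_0_iff[OF \<open>0 < s\<close> \<open>s < 1\<close> ImU oddU] by simp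
  also have "\<dots> \<longleftrightarrow> (\<forall>h. \<forall>c>0. (\<integral>x. exp (- (c * (norm x)\<^sup>2)) * ((h \<bullet> x) * u\<^sub>0 x) \<partial>lborel) = 0)"
    unfolding U_def using gaussian_moments_fourier_eq_0_iff[OF u] by simp
  also have "\<dots> \<longleftrightarrow> (\<forall>h. \<forall>r\<ge>0. (\<integral>\<omega>. (h \<bullet> \<omega>) * u\<^sub>0 (r *\<^sub>R \<omega>) \<partial>sphere_measure) = 0)"
    using spherical_moment_eq_0_iff[OF test_function_continuous[OF u] R] by simp
  also have "\<dots> \<longleftrightarrow> (\<forall>r\<ge>0. (\<integral>\<omega>. u\<^sub>0 (r *\<^sub>R \<omega>) *\<^sub>R \<omega> \<partial>sphere_measure) = 0)"
    using sphere by blast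
  finally show ?thesis .
qed

end
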